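(* Let $n$ be an odd positive integer. Then there exists $\theta_c>0$ such that, for $0<\theta<\theta_c$, the nodal set $N(\Phi^{\theta}_n)$ is a connected simple regular curve, and the eigenfunction $\Phi^{\theta}_n$ has exactly two nodal domains in $\mathbb{R}^2$.
   Context: $H_n$ denotes the (physicists') Hermite polynomial of degree $n$: $H_0(t)=1$, $H_1(t)=2t$, $H_n(t)=2tH_{n-1}(t)-2(n-1)H_{n-2}(t)$ for $n\ge 2$. For $\theta\in[0,\pi[$ and $(x,y)\in\mathbb{R}^2$, set $$\Phi^{\theta}_{n}(x,y) = \left( \cos\theta \, H_n(x) + \sin\theta \, H_n(y) \right)\exp\left(- \tfrac{x^2+y^2}{2}\right).$$ This is an eigenfunction of the harmonic oscillator $\widehat H=-\Delta+|x|^2$ on $L^2(\mathbb{R}^2)$ with eigenvalue $2(n+1)$. The nodal set $N(u)$ of an eigenfunction $u$ is the closure of its zero set $\{u=0\}$, and its nodal domains are the connected components of $\mathbb{R}^2\setminus N(u)$. *)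

theory Defs
  imports "HOL-Analysis.Analysis"
begin

fun hermite :: "nat \<Rightarrow> real \<Rightarrow> real" where
  "hermite 0 t = 1"
| "hermite (Suc 0) t = 2 * t"
| "hermite (Suc (Suc m)) t = 2 * t * hermite (Suc m) t - 2 * real (Suc m) * hermite m t"

definition Phi :: "nat \<Rightarrow> real \<Rightarrow> real \<times> real \<Rightarrow> real" where
  "Phi n \<theta> = (\<lambda>(x, y). (cos \<theta> * hermite n x + sin \<theta> * hermite n y) * exp (- (x\<^sup>2 + y\<^sup>2) / 2))"

definition nodal_set :: "('a::topological_space \<Rightarrow> real) \<Rightarrow> 'a set" where
  "nodal_set u = closure {z. u z = 0}"

definition nodal_domains :: "('a::topological_space \<Rightarrow> real) \<Rightarrow> 'a set set" where
  "nodal_domains u = components (- nodal_set u)"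

text \<open>
  A \<open>C\<^sup>\<infinity>\<close> immersion of the open set \<open>I\<close>; \<open>D k\<close> is the derivative of order \<open>k\<close> of \<open>\<gamma>\<close> on \<open>I\<close>.
\<close>
definition regular_parametrization :: "real set \<Rightarrow> (real \<Rightarrow> 'a::real_normed_vector) \<Rightarrow> bool" where
  "regular_parametrization I \<gamma> \<longleftrightarrow>
     (\<exists>D :: nat \<Rightarrow> real \<Rightarrow> 'a. D 0 = \<gamma> \<and>
        (\<forall>k. \<forall>t\<in>I. (D k has_vector_derivative D (Suc k) t) (at t)) \<and>
        (\<forall>t\<in>I. D 1 t \<noteq> 0))"

text \<open>
  A simple regular curve is either an open arc or a closed curve. For an open arc injectivity of
  the parametrization is not enough: an end of the arc could accumulate at an interior point
  (as in the shape of the digit 6), so the parametrization has to be a homeomorphism onto its image.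
  For a closed curve this is automatic.
\<close>
definition simple_regular_arc :: "'a::real_normed_vector set \<Rightarrow> bool" where
  "simple_regular_arc C \<longleftrightarrow>
     (\<exists>I \<gamma> \<delta>. open I \<and> is_interval I \<and> I \<noteq> {} \<and>
        regular_parametrization I \<gamma> \<and> homeomorphism I C \<gamma> \<delta>)"

definition simple_regular_closed_curve :: "'a::real_normed_vector set \<Rightarrow> bool" where
  "simple_regular_closed_curve C \<longleftrightarrow>
     (\<exists>T \<gamma>. T > 0 \<and> regular_parametrization UNIV \<gamma> \<and> (\<forall>t. \<gamma> (t + T) = \<gamma> t) \<and>
        inj_on \<gamma> {0..<T} \<and> range \<gamma> = C)"

definition simple_regular_curve :: "'a::real_normed_vector set \<Rightarrow> bool" where
  "simple_regular_curve C \<longleftrightarrow> simple_regular_arc C \<or> simple_regular_closed_curve C"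

end

theory Submission
  imports Defs
begin

text \<open>
  The zero set is the level curve \<open>P x = Q y\<close> with \<open>P = - cos \<theta> H\<^sub>n\<close> and \<open>Q = sin \<theta> H\<^sub>n\<close>. Take \<open>Y\<close> so large
  that \<open>Q\<close> is increasing beyond \<open>\<plusminus>Y\<close> and \<open>\<bar>Q\<bar> < Q Y\<close> on \<open>]-Y, Y[\<close>. As \<open>H\<^sub>n\<close> has no multiple root, for small \<open>\<theta>\<close>
  all critical values of \<open>P\<close> exceed \<open>Q Y\<close> in absolute value. Cut the plane along the finitely many
  lines \<open>x = p\<close> with \<open>\<bar>P p\<bar> = Q Y\<close>. Over a strip where \<open>\<bar>P\<bar> \<ge> Q Y\<close> the curve is a graph over \<open>x\<close> lying in
  \<open>\<bar>y\<bar> \<ge> Y\<close>; over a strip where \<open>\<bar>P\<bar> \<le> Q Y\<close>, \<open>P\<close> is monotone and the curve is a graph over \<open>y \<in> [-Y, Y]\<close>.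
  Each piece, traversed from left to right, is an integral curve of the polynomial field
  \<open>(Q' y, P' x)\<close>, which is tangent to all level curves of \<open>P x - Q y\<close>. Pieces of integral curves of
  one field can be joined end to end without losing smoothness, so the zero set is a single smooth arc.
  A point of \<open>{P x < Q y}\<close> can be moved inside this set, first horizontally to the
  end of its strip where \<open>P = - Q Y\<close> and then vertically, into the part of it above \<open>y = Y\<close>, which is
  connected; the other side is treated by the reflection \<open>(P, y) \<mapsto> (- P, - y)\<close>.
\<close>

section \<open>Polynomial flows and their integral arcs\<close>

text \<open>The Lie derivative along a polynomial field maps polynomials to polynomials: a linear
  \<open>f\<close> gives \<open>f \<circ> V\<close>, and sums and products follow the usual rules.
  One \<open>g\<close> serves all integral curves at once, which allows iteration.\<close>

lemma real_polynomial_function_along_flow: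
  fixes V :: "'a::euclidean_space \<Rightarrow> 'a"
  assumes "polynomial_function V" "real_polynomial_function f"
  shows "\<exists>g. real_polynomial_function g \<and>
    (\<forall>\<gamma> t. (\<gamma> has_vector_derivative V (\<gamma> t)) (at t) \<longrightarrow>
       ((\<lambda>t. f (\<gamma> t)) has_vector_derivative g (\<gamma> t)) (at t))"
  using assms(2)
proof induction
  case (linear f)
  have "real_polynomial_function (f \<circ> V)"
    using assms(1) linear by (auto simp: polynomial_function_def)
  then show ?case
    using bounded_linear.has_vector_derivative[OF linear] by (intro exI[of _ "f \<circ> V"]) (simp del: o_apply, simp)
next
  case (const c)
  show ?case by (rule exI[of _ "\<lambda>_. 0"]) (auto intro: derivative_intros)
next
  case (add f g)
  then obtain f' g' where "real_polynomial_function f'" "real_polynomial_function g'"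
    "\<forall>\<gamma> t. (\<gamma> has_vector_derivative V (\<gamma> t)) (at t) \<longrightarrow>
       ((\<lambda>t. f (\<gamma> t)) has_vector_derivative f' (\<gamma> t)) (at t)"
    "\<forall>\<gamma> t. (\<gamma> has_vector_derivative V (\<gamma> t)) (at t) \<longrightarrow>
       ((\<lambda>t. g (\<gamma> t)) has_vector_derivative g' (\<gamma> t)) (at t)" by blast
  then show ?case
    by (intro exI[of _ "\<lambda>x. f' x + g' x"]) (auto intro!: derivative_intros)
next
  case (mult f g)
  then obtain f' g' where *: "real_polynomial_function f'" "real_polynomial_function g'"
    "\<forall>\<gamma> t. (\<gamma> has_vector_derivative V (\<gamma> t)) (at t) \<longrightarrow>
       ((\<lambda>t. f (\<gamma> t)) has_vector_derivative f' (\<gamma> t)) (at t)"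
    "\<forall>\<gamma> t. (\<gamma> has_vector_derivative V (\<gamma> t)) (at t) \<longrightarrow>
       ((\<lambda>t. g (\<gamma> t)) has_vector_derivative g' (\<gamma> t)) (at t)" by blast
  show ?case
    by (intro exI[of _ "\<lambda>x. f x * g' x + f' x * g x"] conjI allI impI
        has_vector_derivative_mult real_polynomial_function.intros *(1,2) *(3,4)[rule_format] mult.hyps)
qed

lemma polynomial_function_along_flow:
  fixes V :: "'a::euclidean_space \<Rightarrow> 'a" and f :: "'a \<Rightarrow> 'b::euclidean_space"
  assumes "polynomial_function V" "polynomial_function f"
  shows "\<exists>g. polynomial_function g \<and>
    (\<forall>\<gamma> t. (\<gamma> has_vector_derivative V (\<gamma> t)) (at t) \<longrightarrow>
       ((\<lambda>t. f (\<gamma> t)) has_vector_derivative g (\<gamma> t)) (at t))"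
proof -
  have "\<forall>b\<in>Basis. \<exists>g. real_polynomial_function g \<and>
    (\<forall>\<gamma> t. (\<gamma> has_vector_derivative V (\<gamma> t)) (at t) \<longrightarrow>
       ((\<lambda>t. f (\<gamma> t) \<bullet> b) has_vector_derivative g (\<gamma> t)) (at t))"
    using assms(2) by (intro ballI real_polynomial_function_along_flow[OF assms(1)])
      (simp add: polynomial_function_iff_Basis_inner)
  then obtain g where g: "\<And>b. b \<in> Basis \<Longrightarrow> real_polynomial_function (g b)"
    "\<And>b \<gamma> t. b \<in> Basis \<Longrightarrow> (\<gamma> has_vector_derivative V (\<gamma> t)) (at t) \<Longrightarrow>
       ((\<lambda>t. f (\<gamma> t) \<bullet> b) has_vector_derivative g b (\<gamma> t)) (at t)"
    unfolding bchoice_iff by blast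
  show ?thesis
  proof (intro exI conjI allI impI)
    show "polynomial_function (\<lambda>x. \<Sum>b\<in>Basis. g b x *\<^sub>R b)"
      using g(1) by (auto simp: polynomial_function_iff_Basis_inner)
    fix \<gamma> t assume "(\<gamma> has_vector_derivative V (\<gamma> t)) (at t)"
    then have "((\<lambda>t. \<Sum>b\<in>Basis. (f (\<gamma> t) \<bullet> b) *\<^sub>R b) has_vector_derivative (\<Sum>b\<in>Basis. g b (\<gamma> t) *\<^sub>R b)) (at t)"
      by (intro has_vector_derivative_sum bounded_linear.has_vector_derivative[OF bounded_linear_scaleR_left] g(2))
    then show "((\<lambda>t. f (\<gamma> t)) has_vector_derivative (\<Sum>b\<in>Basis. g b (\<gamma> t) *\<^sub>R b)) (at t)"
      by (simp add: euclidean_representation)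
  qed
qed

text \<open>Smoothness comes from iterating the Lie derivative, starting with the identity: every
  derivative of \<open>\<gamma>\<close> is a polynomial function of \<open>\<gamma> t\<close>, hence
  differentiable again.\<close>

lemma regular_parametrization_polynomial_flow:
  fixes V :: "'a::euclidean_space \<Rightarrow> 'a"
  assumes V: "polynomial_function V"
    and \<gamma>: "\<And>t. t \<in> I \<Longrightarrow> (\<gamma> has_vector_derivative V (\<gamma> t)) (at t)"
    and nz: "\<And>t. t \<in> I \<Longrightarrow> V (\<gamma> t) \<noteq> 0"
  shows "regular_parametrization I \<gamma>"
proof -
  have "\<exists>F :: nat \<Rightarrow> 'a \<Rightarrow> 'a. \<forall>k. (polynomial_function (F k) \<and> (k = 0 \<longrightarrow> F k = (\<lambda>x. x))) \<and>
    (\<forall>\<gamma> t. (\<gamma> has_vector_derivative V (\<gamma> t)) (at t) \<longrightarrow>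
       ((\<lambda>t. F k (\<gamma> t)) has_vector_derivative F (Suc k) (\<gamma> t)) (at t))"
    by (rule dependent_nat_choice) (use polynomial_function_along_flow[OF V] in auto)
  then obtain F :: "nat \<Rightarrow> 'a \<Rightarrow> 'a" where F: "F 0 = (\<lambda>x. x)"
    "\<And>k \<gamma> t. (\<gamma> has_vector_derivative V (\<gamma> t)) (at t) \<Longrightarrow>
       ((\<lambda>t. F k (\<gamma> t)) has_vector_derivative F (Suc k) (\<gamma> t)) (at t)"
    by blast
  \<comment> \<open>The choice of \<open>F 1\<close> is tied to \<open>V\<close> only along integral
    curves; uniqueness of the derivative gives
    \<open>F 1 (\<gamma> t) = V (\<gamma> t)\<close>.\<close>
  have "F 1 (\<gamma> t) \<noteq> 0" if "t \<in> I" for t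
    using F(2)[OF \<gamma>[OF that], of 0] \<gamma>[OF that] nz[OF that]
    by (auto simp: F(1) dest: vector_derivative_unique_at)
  then show ?thesis
    unfolding regular_parametrization_def
    by (intro exI[of _ "\<lambda>k t. F k (\<gamma> t)"]) (use F \<gamma> in auto)
qed

text \<open>By Tietze the integrand extends continuously from the closed set to the whole line, so
  the antiderivative has two-sided derivatives even at the ends of \<open>J\<close>.\<close>

lemma continuous_imp_antiderivative:
  fixes f :: "real \<Rightarrow> real"
  assumes "continuous_on J f" "closed J"
  shows "\<exists>F. \<forall>x\<in>J. (F has_real_derivative f x) (at x)"
proof -
  obtain g where g: "continuous_on UNIV g" "\<And>x. x \<in> J \<Longrightarrow> g x = f x"
    using Tietze_unbounded[OF assms(1), of UNIV] assms(2) by auto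
  \<comment> \<open>One of the two integrals is always over an empty or one-point interval, so this
    is the signed integral from 0 to \<open>x\<close>. Near a given point it differs by a constant
    from an integral with lower limit \<open>a\<close>.\<close>
  let ?F = "\<lambda>x. integral {0..x} g - integral {x..0} g"
  have "(?F has_real_derivative g x) (at x)" for x
  proof -
    define a b where "a = min 0 x - 1" and "b = max 0 x + 1"
    have ab: "a < x" "x < b" "a < 0" "0 < b" by (auto simp: a_def b_def)
    have int: "g integrable_on {u..v}" for u v
      by (rule integrable_continuous_interval) (rule continuous_on_subset[OF g(1)], simp)
    have eq: "?F u = integral {a..u} g - integral {a..0} g" if "u \<in> {a<..<b}" for u
    proof (cases "u \<ge> 0")
      case True
      then show ?thesis
        using Henstock_Kurzweil_Integration.integral_combine[of a 0 u g] ab int by (cases "u = 0") auto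
    next
      case False
      then show ?thesis
        using Henstock_Kurzweil_Integration.integral_combine[of a u 0 g] ab int that by auto
    qed
    have "((\<lambda>u. integral {a..u} g) has_real_derivative g x) (at x within {a..b})"
      using ab by (intro integral_has_real_derivative continuous_on_subset[OF g(1)]) auto
    then have "((\<lambda>u. integral {a..u} g) has_real_derivative g x) (at x)"
      using ab at_within_Icc_at[of a x b] by simp
    then have "((\<lambda>u. integral {a..u} g - integral {a..0} g) has_real_derivative g x) (at x)"
      by (auto intro!: derivative_eq_intros)
    then show ?thesis
      by (rule DERIV_cong_ev[OF refl _ refl, THEN iffD2, rotated])
        (use ab eq in \<open>auto intro!: eventually_nhds_in_open[of "{a<..<b}" x, THEN eventually_mono]\<close>)
  qed
  then show ?thesis using g(2) by (intro exI[of _ ?F] ballI) metis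
qed

text \<open>Caratheodory's factorization \<open>Q z - Q (g x) = r z * (z - g x)\<close> turns the
  difference quotient of \<open>g\<close> into that of \<open>P\<close> divided by
  \<open>r (g u)\<close>, which tends to \<open>q\<close> by continuity of \<open>g\<close>. It
  serves both for inverse functions and for solving \<open>Q y = P x\<close>.\<close>

lemma has_real_derivative_implicit:
  fixes g P Q :: "real \<Rightarrow> real"
  assumes g: "continuous (at x within S) g" and eq: "\<And>u. u \<in> S \<Longrightarrow> Q (g u) = P u" and "x \<in> S"
    and Q: "(Q has_real_derivative q) (at (g x))" and P: "(P has_real_derivative p) (at x within S)"
    and "q \<noteq> 0"
  shows "(g has_real_derivative p / q) (at x within S)"
proof -
  obtain r where r: "\<And>z. Q z - Q (g x) = r z * (z - g x)" "isCont r (g x)" "r (g x) = q"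
    using Q by (auto simp: CARAT_DERIV)
  have lim: "((\<lambda>u. r (g u)) \<longlongrightarrow> q) (at x within S)"
    using isCont_tendsto_compose[OF r(2)] g r(3) by (auto simp: continuous_within)
  have "((\<lambda>u. ((P u - P x) / (u - x)) / r (g u)) \<longlongrightarrow> p / q) (at x within S)"
    using P by (intro tendsto_divide lim \<open>q \<noteq> 0\<close>) (simp add: has_field_derivative_iff)
  moreover have "eventually (\<lambda>u. ((P u - P x) / (u - x)) / r (g u) = (g u - g x) / (u - x)) (at x within S)"
  proof -
    have "eventually (\<lambda>u. r (g u) \<noteq> 0) (at x within S)"
      using lim \<open>q \<noteq> 0\<close> by (rule tendsto_imp_eventually_ne)
    moreover have "eventually (\<lambda>u. u \<in> S) (at x within S)"
      by (simp add: eventually_at_filter)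
    ultimately show ?thesis
    proof eventually_elim
      case (elim u)
      then have "P u - P x = r (g u) * (g u - g x)" using r(1)[of "g u"] eq \<open>x \<in> S\<close> by simp
      then show ?case using elim by simp
    qed
  qed
  ultimately show ?thesis
    by (auto simp: has_field_derivative_iff elim: Lim_transform_eventually)
qed

text \<open>The derivative is taken within \<open>I\<close>, so arcs may contain their endpoints
  with one-sided derivatives there; this is the form in which pieces are joined.\<close>

definition integral_arc :: "('a::real_normed_vector \<Rightarrow> 'a) \<Rightarrow> real set \<Rightarrow> (real \<Rightarrow> 'a) \<Rightarrow> 'a set \<Rightarrow> bool" where
  "integral_arc V I \<gamma> C \<longleftrightarrow> is_interval I \<and> (\<exists>\<delta>. homeomorphism I C \<gamma> \<delta>) \<and>
     (\<forall>t\<in>I. (\<gamma> has_vector_derivative V (\<gamma> t)) (at t within I))"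

text \<open>A curve with velocity \<open>l\<close> times \<open>V\<close> becomes an integral curve
  in the new time \<open>\<phi>\<close>, an antiderivative of \<open>l\<close>;
  \<open>\<gamma>\<close> is \<open>\<sigma>\<close> composed with the inverse of
  \<open>\<phi>\<close>.\<close>

lemma integral_arc_reparametrize:
  assumes J: "is_interval J" "closed J"
    and \<sigma>: "homeomorphism J C \<sigma> \<rho>"
    and lam: "continuous_on J l" "\<And>s. s \<in> J \<Longrightarrow> l s > 0"
    and \<sigma>': "\<And>s. s \<in> J \<Longrightarrow> (\<sigma> has_vector_derivative l s *\<^sub>R V (\<sigma> s)) (at s within J)"
  obtains I \<gamma> \<phi> where "integral_arc V I \<gamma> C" "strict_mono_on J \<phi>" "\<phi> ` J = I" "\<And>s. s \<in> J \<Longrightarrow> \<gamma> (\<phi> s) = \<sigma> s"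
proof -
  obtain \<phi> where "\<forall>s\<in>J. (\<phi> has_real_derivative l s) (at s)"
    using continuous_imp_antiderivative[OF lam(1) J(2)] ..
  then have \<phi>: "(\<phi> has_real_derivative l s) (at s)" if "s \<in> J" for s
    using that by simp
  have mono: "strict_mono_on J \<phi>"
  proof (rule strict_mono_onI)
    fix r s assume "r \<in> J" "s \<in> J" "r < s"
    then have "x \<in> J" if "r \<le> x" "x \<le> s" for x
      using mem_is_interval_1_I[OF J(1), of r s x] that by simp
    then have ex: "\<exists>y. (\<phi> has_real_derivative y) (at x) \<and> y > 0" if "r \<le> x" "x \<le> s" for x
      using \<phi>[of x] lam(2)[of x] that by force
    show "\<phi> r < \<phi> s"
      by (rule DERIV_pos_imp_increasing[OF \<open>r < s\<close>]) (rule ex)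
  qed
  have cont: "continuous_on J \<phi>"
    using \<phi> by (auto intro!: continuous_at_imp_continuous_on DERIV_isCont)
  obtain \<psi> where \<psi>: "homeomorphism J (\<phi> ` J) \<phi> \<psi>"
    using homeomorphism_into_1d[OF is_interval_path_connected[OF J(1)] cont refl strict_mono_on_imp_inj_on[OF mono]]
    by blast
  have \<psi>in: "\<psi> t \<in> J" if "t \<in> \<phi> ` J" for t using \<psi> that by (auto simp: homeomorphism_def)
  have "integral_arc V (\<phi> ` J) (\<sigma> \<circ> \<psi>) C"
    unfolding integral_arc_def
  proof (intro conjI ballI)
    show "is_interval (\<phi> ` J)" 
      using J(1) cont by (simp add: is_interval_connected_1 connected_continuous_image)
    show "\<exists>\<delta>. homeomorphism (\<phi> ` J) C (\<sigma> \<circ> \<psi>) \<delta>"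
      using homeomorphism_compose[OF homeomorphism_symD[OF \<psi>] \<sigma>] by blast
    fix t assume t: "t \<in> \<phi> ` J"
    have s: "\<psi> t \<in> J" "\<phi> (\<psi> t) = t" using \<psi>in t \<psi> by (auto simp: homeomorphism_def)
    have "continuous (at t within \<phi> ` J) \<psi>"
      using \<psi> t by (auto simp: homeomorphism_def continuous_on_eq_continuous_within)
    then have "(\<psi> has_real_derivative 1 / l (\<psi> t)) (at t within \<phi> ` J)"
      using has_real_derivative_implicit[of t "\<phi> ` J" \<psi> \<phi> "\<lambda>x. x" "l (\<psi> t)" 1] t \<phi>[OF s(1)] lam(2)[OF s(1)] \<psi>
      by (auto simp: homeomorphism_def)
    then have \<psi>': "(\<psi> has_vector_derivative 1 / l (\<psi> t)) (at t within \<phi> ` J)"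
      by (simp add: has_real_derivative_iff_has_vector_derivative)
    have "\<psi> ` \<phi> ` J = J" using \<psi> by (auto simp: homeomorphism_def)
    then have "(\<sigma> \<circ> \<psi> has_vector_derivative (1 / l (\<psi> t)) *\<^sub>R (l (\<psi> t) *\<^sub>R V (\<sigma> (\<psi> t)))) (at t within \<phi> ` J)"
      using \<sigma>'[OF s(1)] by (intro vector_diff_chain_within[OF \<psi>']) simp
    then show "(\<sigma> \<circ> \<psi> has_vector_derivative V ((\<sigma> \<circ> \<psi>) t)) (at t within \<phi> ` J)"
      using lam(2)[OF s(1)] by simp
  qed
  then show thesis by (rule that[OF _ mono refl]) (use \<psi> in \<open>simp add: homeomorphism_def\<close>)
qed

text \<open>At the junction both one-sided derivatives equal \<open>V (\<gamma> b)\<close>, so the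
  joined curve is differentiable there. Closedness of both images lets the two inverses be pasted
  continuously.\<close>

lemma integral_arc_join:
  assumes A: "integral_arc V I \<gamma> A" and B: "integral_arc V J \<eta> B"
    and I: "b \<in> I" "\<And>t. t \<in> I \<Longrightarrow> t \<le> b" and J: "b \<in> J" "\<And>t. t \<in> J \<Longrightarrow> b \<le> t"
    and eq: "\<gamma> b = \<eta> b" and AB: "A \<inter> B \<subseteq> {\<gamma> b}" and cl: "closed A" "closed B"
  shows "integral_arc V (I \<union> J) (\<lambda>t. if t \<in> I then \<gamma> t else \<eta> t) (A \<union> B)" (is "integral_arc V _ ?\<zeta> _")
proof -
  obtain \<gamma>' \<eta>' where h: "homeomorphism I A \<gamma> \<gamma>'" "homeomorphism J B \<eta> \<eta>'"
    using A B by (auto simp: integral_arc_def)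
  have IJ: "t = b" if "t \<in> I" "t \<in> J" for t using that I(2)[of t] J(2)[of t] by simp
  have cI: "closure I \<subseteq> {..b}" by (rule closure_minimal) (use I in auto)
  have cJ: "closure J \<subseteq> {b..}" by (rule closure_minimal) (use J in auto)
  have clIJ: "closure I \<inter> closure J = {b}"
    using cI cJ I(1) J(1) closure_subset[of I] closure_subset[of J] by fastforce
  have uI: "I \<union> (closure I \<inter> closure J) = I" and uJ: "J \<union> (closure I \<inter> closure J) = J"
    using clIJ I J by auto
  have der: "(?\<zeta> has_vector_derivative V (?\<zeta> t)) (at t within I \<union> J)" if t: "t \<in> I \<union> J" for t
  proof -
    have "(?\<zeta> has_vector_derivative (if t \<in> I then V (\<gamma> t) else V (\<eta> t))) (at t within I \<union> J)"
    proof (rule has_vector_derivative_If_within_closures[OF t refl])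
      show "\<gamma> t = \<eta> t" if "t \<in> closure I" "t \<in> closure J" using that clIJ eq by auto
      then show "V (\<gamma> t) = V (\<eta> t)" if "t \<in> closure I" "t \<in> closure J" using that by simp
    qed (use A B uI uJ in \<open>auto simp: integral_arc_def\<close>)
    then show ?thesis by (simp split: if_splits)
  qed
  have "homeomorphism (I \<union> J) (A \<union> B) ?\<zeta> (\<lambda>z. if z \<in> A then \<gamma>' z else \<eta>' z)"
  proof (rule homeomorphismI)
    show "continuous_on (I \<union> J) ?\<zeta>"
      unfolding continuous_on_eq_continuous_within
      using der has_vector_derivative_continuous by blast
    show "continuous_on (A \<union> B) (\<lambda>z. if z \<in> A then \<gamma>' z else \<eta>' z)"
    proof (rule continuous_on_cases[OF cl])
      have "\<gamma>' (\<gamma> b) = b" "\<eta>' (\<eta> b) = b" using h I J by (auto simp: homeomorphism_def)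
      then show "\<forall>z. z \<in> A \<and> z \<notin> A \<or> z \<in> B \<and> z \<in> A \<longrightarrow> \<gamma>' z = \<eta>' z"
        using AB eq by auto
    qed (use h in \<open>auto simp: homeomorphism_def\<close>)
    show "?\<zeta> ` (I \<union> J) \<subseteq> A \<union> B"
      using h by (auto simp: homeomorphism_def)
    show "(\<lambda>z. if z \<in> A then \<gamma>' z else \<eta>' z) ` (A \<union> B) \<subseteq> I \<union> J"
      using h by (auto simp: homeomorphism_def)
    show "(if ?\<zeta> t \<in> A then \<gamma>' (?\<zeta> t) else \<eta>' (?\<zeta> t)) = t" if t: "t \<in> I \<union> J" for t
    proof (cases "t \<in> I")
      case True
      then show ?thesis using h by (auto simp: homeomorphism_def)
    next
      case False
      then have J': "t \<in> J" using t by simp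
      have "\<eta> t \<notin> A"
      proof
        assume "\<eta> t \<in> A"
        then have "\<eta> t = \<eta> b" using AB eq J' h by (auto simp: homeomorphism_def)
        then have "t = b" using J' J(1) h by (metis homeomorphism_apply1)
        then show False using False I by simp
      qed
      then show ?thesis using False J' h by (auto simp: homeomorphism_def)
    qed
    show "?\<zeta> (if z \<in> A then \<gamma>' z else \<eta>' z) = z" if z: "z \<in> A \<union> B" for z
    proof (cases "z \<in> A")
      case True
      then show ?thesis using h by (auto simp: homeomorphism_def)
    next
      case False
      then have z: "z \<in> B" using z by simp
      have "\<eta>' z \<in> J" using z h by (auto simp: homeomorphism_def)
      moreover have "\<eta>' z \<notin> I"
      proof
        assume "\<eta>' z \<in> I"
        then have "\<eta>' z = b" using IJ \<open>\<eta>' z \<in> J\<close> by simp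
        then have "z = \<gamma> b" using z eq h by (metis homeomorphism_apply2)
        then show False using False I h by (auto simp: homeomorphism_def)
      qed
      ultimately show ?thesis using False z h by (auto simp: homeomorphism_def)
    qed
  qed
  moreover have "is_interval (I \<union> J)"
    using A B I J unfolding is_interval_connected_1 integral_arc_def
    by (intro connected_Un) auto
  ultimately show ?thesis using der by (auto simp: integral_arc_def)
qed

lemma integral_arc_translate:
  assumes "integral_arc V I \<gamma> C"
  shows "integral_arc V ((+) d ` I) (\<lambda>t. \<gamma> (t - d)) C"
proof -
  obtain \<delta> where h: "homeomorphism I C \<gamma> \<delta>" using assms by (auto simp: integral_arc_def)
  have "homeomorphism ((+) d ` I) I (\<lambda>t. t - d) ((+) d)"
    by (rule homeomorphismI) (auto intro!: continuous_intros)
  then have "homeomorphism ((+) d ` I) C (\<lambda>t. \<gamma> (t - d)) ((+) d \<circ> \<delta>)"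
    using homeomorphism_compose[OF _ h] by (fastforce simp: o_def)
  moreover have "((\<lambda>t. \<gamma> (t - d)) has_vector_derivative V (\<gamma> (t - d))) (at t within (+) d ` I)"
    if "t \<in> (+) d ` I" for t
  proof -
    have im: "(\<lambda>t. t - d) ` (+) d ` I = I" by (auto simp: image_image)
    have "((\<lambda>t. t - d) has_vector_derivative 1) (at t within (+) d ` I)"
      by (auto intro!: derivative_eq_intros)
    then have "(\<gamma> \<circ> (\<lambda>t. t - d) has_vector_derivative 1 *\<^sub>R V (\<gamma> (t - d))) (at t within (+) d ` I)"
      by (rule vector_diff_chain_within) (use assms that im in \<open>auto simp: integral_arc_def\<close>)
    then show ?thesis by (simp add: o_def)
  qed
  moreover have "is_interval ((+) d ` I)"
    using assms unfolding integral_arc_def is_interval_connected_1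
    by (intro connected_continuous_image) (auto intro!: continuous_intros)
  ultimately show ?thesis by (auto simp: integral_arc_def)
qed

text \<open>The endpoints of an arc are recorded as points of its image; an absent endpoint means that the
  parameter interval has no least (or no greatest) element.\<close>

definition arc_from :: "real set \<Rightarrow> (real \<Rightarrow> 'a) \<Rightarrow> 'a option \<Rightarrow> bool" where
  "arc_from I \<gamma> w \<longleftrightarrow>
     (case w of None \<Rightarrow> (\<forall>t\<in>I. \<exists>u\<in>I. u < t) | Some z \<Rightarrow> (\<exists>a\<in>I. (\<forall>t\<in>I. a \<le> t) \<and> \<gamma> a = z))"

definition arc_to :: "real set \<Rightarrow> (real \<Rightarrow> 'a) \<Rightarrow> 'a option \<Rightarrow> bool" where
  "arc_to I \<gamma> w \<longleftrightarrow>
     (case w of None \<Rightarrow> (\<forall>t\<in>I. \<exists>u\<in>I. t < u) | Some z \<Rightarrow> (\<exists>b\<in>I. (\<forall>t\<in>I. t \<le> b) \<and> \<gamma> b = z))"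

text \<open>The parametrization is hidden, since joining and changes of time alter it; what is kept
  is the image and its ends in the direction of \<open>V\<close>.\<close>

definition flow_arc :: "('a::real_normed_vector \<Rightarrow> 'a) \<Rightarrow> 'a option \<Rightarrow> 'a option \<Rightarrow> 'a set \<Rightarrow> bool" where
  "flow_arc V w z C \<longleftrightarrow> (\<exists>I \<gamma>. I \<noteq> {} \<and> integral_arc V I \<gamma> C \<and> arc_from I \<gamma> w \<and> arc_to I \<gamma> z)"

lemma flow_arc_join:
  assumes A: "flow_arc V w (Some p) A" and B: "flow_arc V (Some p) z B"
    and AB: "A \<inter> B \<subseteq> {p}" and cl: "closed A" "closed B"
  shows "flow_arc V w z (A \<union> B)"
proof -
  obtain I \<gamma> where I: "I \<noteq> {}" "integral_arc V I \<gamma> A" "arc_from I \<gamma> w" "arc_to I \<gamma> (Some p)"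
    using A by (auto simp: flow_arc_def)
  obtain J \<eta> where J: "J \<noteq> {}" "integral_arc V J \<eta> B" "arc_from J \<eta> (Some p)" "arc_to J \<eta> z"
    using B by (auto simp: flow_arc_def)
  obtain b where b: "b \<in> I" "\<And>t. t \<in> I \<Longrightarrow> t \<le> b" "\<gamma> b = p"
    using I(4) by (auto simp: arc_to_def)
  obtain a where a: "a \<in> J" "\<And>t. t \<in> J \<Longrightarrow> a \<le> t" "\<eta> a = p"
    using J(3) by (auto simp: arc_from_def)
  \<comment> \<open>Shifting time by \<open>b - a\<close> makes the second arc start at the time
    when the first one stops.\<close>
  define K where "K = (+) (b - a) ` J"
  define \<kappa> where "\<kappa> t = \<eta> (t - (b - a))" for t
  define \<zeta> where "\<zeta> t = (if t \<in> I then \<gamma> t else \<kappa> t)" for t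
  have K: "b \<in> K" "\<And>t. t \<in> K \<Longrightarrow> b \<le> t" "\<kappa> b = p"
    using a by (force simp: K_def \<kappa>_def)+
  have K': "integral_arc V K \<kappa> B"
    using integral_arc_translate[OF J(2), of "b - a"] unfolding K_def \<kappa>_def .
  have "integral_arc V (I \<union> K) \<zeta> (A \<union> B)"
    unfolding \<zeta>_def by (rule integral_arc_join[OF I(2) K' b(1,2) K(1,2)]) (use b K AB cl in auto)
  moreover have "arc_from (I \<union> K) \<zeta> w"
  proof (cases w)
    case None
    then have *: "\<forall>t\<in>I. \<exists>u\<in>I. u < t" using I(3) by (auto simp: arc_from_def)
    then obtain u where "u \<in> I" "u < b" using b(1) by blast
    then have "\<exists>u\<in>I. u < t" if "t \<in> K" for t
      using K(2)[OF that] by (intro bexI[of _ u]) auto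
    then show ?thesis using None * by (auto simp: arc_from_def)
  next
    case (Some y)
    then obtain c where c: "c \<in> I" "\<And>t. t \<in> I \<Longrightarrow> c \<le> t" "\<gamma> c = y"
      using I(3) by (auto simp: arc_from_def)
    then have "c \<le> t" if "t \<in> I \<union> K" for t
      using that c(2)[OF b(1)] K(2) by fastforce
    then show ?thesis using Some c by (auto simp: arc_from_def \<zeta>_def intro!: bexI[of _ c])
  qed
  moreover have "arc_to (I \<union> K) \<zeta> z"
  proof (cases z)
    case None
    then have *: "\<forall>t\<in>K. \<exists>u\<in>K. t < u" using J(4) by (fastforce simp: arc_to_def K_def)
    then obtain u where "u \<in> K" "b < u" using K(1) by blast
    then have "\<exists>u\<in>K. t < u" if "t \<in> I" for t
      using b(2)[OF that] by (intro bexI[of _ u]) auto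
    then show ?thesis using None * by (auto simp: arc_to_def)
  next
    case (Some y)
    then obtain c where c: "c \<in> J" "\<And>t. t \<in> J \<Longrightarrow> t \<le> c" "\<eta> c = y"
      using J(4) by (auto simp: arc_to_def)
    let ?c = "b - a + c"
    have cK: "?c \<in> K" "\<And>t. t \<in> K \<Longrightarrow> t \<le> ?c" "\<kappa> ?c = y" using c by (auto simp: K_def \<kappa>_def)
    have "\<zeta> ?c = y"
    \<comment> \<open>The last time of the second arc can lie in \<open>I\<close> only if that arc
      is a single point, and then it is the junction time \<open>b\<close>.\<close>
    proof (cases "?c \<in> I")
      case True
      then have "?c = b" using b(2) K(2) cK(1) by force
      then show ?thesis using True b K cK by (simp add: \<zeta>_def)
    qed (use cK in \<open>simp add: \<zeta>_def\<close>)
    moreover have "t \<le> ?c" if "t \<in> I \<union> K" for t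
      using that cK b(2) K(2) by fastforce
    ultimately show ?thesis using Some cK by (auto simp: arc_to_def)
  qed
  ultimately show ?thesis using I(1) unfolding flow_arc_def by blast
qed

text \<open>A strictly increasing change of time keeps least and greatest parameters, and also their
  absence, so the ends can be read off from \<open>\<sigma>\<close>.\<close>

lemma flow_arc_reparametrize:
  assumes J: "is_interval J" "closed J" "J \<noteq> {}"
    and \<sigma>: "homeomorphism J C \<sigma> \<rho>" "arc_from J \<sigma> w" "arc_to J \<sigma> z"
    and lam: "continuous_on J l" "\<And>s. s \<in> J \<Longrightarrow> l s > 0"
    and \<sigma>': "\<And>s. s \<in> J \<Longrightarrow> (\<sigma> has_vector_derivative l s *\<^sub>R V (\<sigma> s)) (at s within J)"
  shows "flow_arc V w z C"
proof -
  obtain I \<gamma> \<phi> where *: "integral_arc V I \<gamma> C" "strict_mono_on J \<phi>" "I = \<phi> ` J"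
    "\<And>s. s \<in> J \<Longrightarrow> \<gamma> (\<phi> s) = \<sigma> s"
    using integral_arc_reparametrize[OF J(1,2) \<sigma>(1) lam \<sigma>'] by metis
  have less: "\<phi> r < \<phi> s" if "r \<in> J" "s \<in> J" "r < s" for r s
    using *(2) that by (rule strict_mono_onD)
  have le: "\<phi> r \<le> \<phi> s" if "r \<in> J" "s \<in> J" "r \<le> s" for r s
    using *(2) that by (rule strict_mono_on_leD)
  have "arc_from I \<gamma> w"
  proof (cases w)
    case None
    then show ?thesis using \<sigma>(2) less unfolding *(3) arc_from_def by simp meson
  next
    case (Some y)
    then obtain a where "a \<in> J" "\<forall>t\<in>J. a \<le> t" "\<sigma> a = y" using \<sigma>(2) by (auto simp: arc_from_def)
    then show ?thesis using Some le *(4) unfolding *(3) arc_from_def by (auto intro!: bexI[of _ a])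
  qed
  moreover have "arc_to I \<gamma> z"
  proof (cases z)
    case None
    then show ?thesis using \<sigma>(3) less unfolding *(3) arc_to_def by simp meson
  next
    case (Some y)
    then obtain a where "a \<in> J" "\<forall>t\<in>J. t \<le> a" "\<sigma> a = y" using \<sigma>(3) by (auto simp: arc_to_def)
    then show ?thesis using Some le *(4) unfolding *(3) arc_to_def by (auto intro!: bexI[of _ a])
  qed
  ultimately show ?thesis using *(1,3) J(3) unfolding flow_arc_def
    by (intro exI[of _ I] exI[of _ \<gamma>]) simp
qed

lemma open_flow_arc:
  assumes "flow_arc V None None C"
  obtains I \<gamma> where "open I" "I \<noteq> {}" "integral_arc V I \<gamma> C"
proof -
  obtain I \<gamma> where I: "I \<noteq> {}" "integral_arc V I \<gamma> C" "arc_from I \<gamma> None" "arc_to I \<gamma> None"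
    using assms by (auto simp: flow_arc_def)
  have "open I"
  proof (subst open_subopen, intro ballI)
    fix t assume "t \<in> I"
    then obtain u v where uv: "u \<in> I" "v \<in> I" "u < t" "t < v"
      using I(3,4) unfolding arc_from_def arc_to_def option.case by blast
    have "x \<in> I" if "u < x" "x < v" for x
      using I(2) mem_is_interval_1_I[of I u v x] uv that by (simp add: integral_arc_def)
    then have "{u<..<v} \<subseteq> I" by auto
    then show "\<exists>T. open T \<and> t \<in> T \<and> T \<subseteq> I" using uv by (intro exI[of _ "{u<..<v}"]) auto
  qed
  then show thesis using I that by blast
qed

text \<open>Without endpoints the parameter interval is open, so the derivatives within it are
  two-sided and the polynomial flow yields smoothness.\<close>

lemma simple_regular_arc_flow_arc:
  fixes V :: "'a::euclidean_space \<Rightarrow> 'a"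
  assumes C: "flow_arc V None None C" and V: "polynomial_function V" "\<And>z. z \<in> C \<Longrightarrow> V z \<noteq> 0"
  shows "simple_regular_arc C" "connected C"
proof -
  obtain I \<gamma> where I: "open I" "I \<noteq> {}" "integral_arc V I \<gamma> C" using open_flow_arc[OF C] .
  then obtain \<delta> where h: "homeomorphism I C \<gamma> \<delta>" by (auto simp: integral_arc_def)
  have "regular_parametrization I \<gamma>"
  proof (rule regular_parametrization_polynomial_flow[OF V(1)])
    show "(\<gamma> has_vector_derivative V (\<gamma> t)) (at t)" if "t \<in> I" for t
      using I that at_within_open[OF that I(1)] by (auto simp: integral_arc_def)
    show "V (\<gamma> t) \<noteq> 0" if "t \<in> I" for t
      using V(2) that h by (auto simp: homeomorphism_def)
  qed
  then show "simple_regular_arc C"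
    using I h unfolding simple_regular_arc_def integral_arc_def by blast
  have "connected (\<gamma> ` I)" 
    using I h by (intro connected_continuous_image) (auto simp: homeomorphism_def integral_arc_def is_interval_connected_1)
  then show "connected C" using h by (auto simp: homeomorphism_def)
qed

section \<open>Level curves of \<open>P x = Q y\<close>\<close>

lemma connected_nonzero_sign:
  fixes f :: "'a::topological_space \<Rightarrow> real"
  assumes "connected S" "continuous_on S f" "\<forall>x\<in>S. f x \<noteq> 0"
  shows "(\<forall>x\<in>S. f x > 0) \<or> (\<forall>x\<in>S. f x < 0)"
proof (rule ccontr)
  assume "\<not> ?thesis"
  then obtain x y where "x \<in> S" "y \<in> S" "f x \<le> 0" "0 \<le> f y" by (meson not_le)
  moreover have "is_interval (f ` S)"
    using assms by (simp add: is_interval_connected_1 connected_continuous_image)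
  ultimately have "0 \<in> f ` S"
    using mem_is_interval_1_I[of "f ` S" "f x" "f y" 0] by simp
  then show False using assms(3) by auto
qed

text \<open>These are the properties on which the topology of the curve rests. The uniform slope
  \<open>\<kappa>\<close> makes \<open>Q\<close> invertible at outer values with a Lipschitz
  inverse; \<open>Q_inner\<close> separates outer from inner heights; \<open>P_finite\<close> and
  \<open>P_attains\<close> give a finite nonempty set of cuts; \<open>P_large\<close> makes the
  curve a graph over \<open>x\<close> on the two unbounded strips.\<close>

locale separated_level_curve =
  fixes P P' Q Q' :: "real \<Rightarrow> real" and Y \<kappa> :: real
  assumes P: "\<And>x. (P has_real_derivative P' x) (at x)"
    and Q: "\<And>y. (Q has_real_derivative Q' y) (at y)"
    and P'_cont: "continuous_on UNIV P'" and Q'_cont: "continuous_on UNIV Q'"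
    and Q_odd: "\<And>y. Q (- y) = - Q y"
    and Y: "Y > 0" and \<kappa>: "\<kappa> > 0"
    and Q'_outer: "\<And>y. Y \<le> \<bar>y\<bar> \<Longrightarrow> \<kappa> \<le> Q' y"
    and Q_inner: "\<And>y. \<bar>y\<bar> < Y \<Longrightarrow> \<bar>Q y\<bar> < Q Y"
    and P'_nonzero: "\<And>x. \<bar>P x\<bar> \<le> Q Y \<Longrightarrow> P' x \<noteq> 0"
    and P_finite: "finite {x. \<bar>P x\<bar> = Q Y}"
    and P_attains: "\<exists>x. \<bar>P x\<bar> = Q Y"
    and P_large: "\<exists>r. \<forall>x. r \<le> \<bar>x\<bar> \<longrightarrow> Q Y < \<bar>P x\<bar>"
begin

definition "Z = {(x, y). P x = Q y}"
definition "V = (\<lambda>(x, y). (Q' y, P' x))"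
text \<open>Meaningful for \<open>Q Y \<le> \<bar>v\<bar>\<close>, where the solution is unique; at
  inner values \<open>Q\<close> may take \<open>v\<close> several times.\<close>

definition "h v = (THE y. Q y = v)"
text \<open>If \<open>Q Y \<le> \<bar>P x\<bar>\<close>, this is the only point of \<open>Z\<close>
  over \<open>x\<close>. At a cut its height is \<open>Y\<close> or \<open>- Y\<close>, so it is a
  corner of a box between cuts.\<close>

definition "corner x = (x, h (P x))"

section \<open>The inverse of \<open>Q\<close> at outer values\<close>

lemma QY_pos: "Q Y > 0" using Q_inner[of 0] Y by simp

lemma P_cont: "continuous_on S P" and Q_cont: "continuous_on S Q"
  by (rule continuous_at_imp_continuous_on, blast intro: DERIV_isCont P Q)+

lemma Q'_even: "Q' (- y) = Q' y"
proof -
  have "((\<lambda>y. Q (- y)) has_real_derivative Q' (- y) * - 1) (at y)"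
    by (rule DERIV_chain2[OF Q]) (auto intro!: derivative_eq_intros)
  from DERIV_minus[OF this] have "(Q has_real_derivative Q' (- y)) (at y)" by (simp add: Q_odd)
  then show ?thesis using DERIV_unique[OF Q] by metis
qed

lemma Q_growth: "\<kappa> * (z - y) \<le> Q z - Q y" if "Y \<le> y" "y \<le> z"
proof (cases "y = z")
  case False
  with that have "y < z" by simp
  from MVT2[OF this Q] obtain c where "y < c" "c < z" "Q z - Q y = (z - y) * Q' c"
    by blast
  moreover have "(z - y) * \<kappa> \<le> (z - y) * Q' c"
    using Q'_outer[of c] that \<open>y < c\<close> by (intro mult_left_mono) auto
  ultimately show ?thesis by (simp add: mult.commute)
qed simp

lemma Q_strict: "Q y < Q z" if "Y \<le> y" "y < z"
proof -
  have "0 < \<kappa> * (z - y)" using that \<kappa> by simp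
  then show ?thesis using Q_growth[of y z] that by linarith
qed

text \<open>A height below \<open>Y\<close> is either inner, where \<open>Q_inner\<close> applies,
  or at most \<open>- Y\<close>, where oddness makes \<open>Q\<close> negative.\<close>

lemma Q_ge_iff: "Q Y \<le> Q y \<longleftrightarrow> Y \<le> y"
proof
  assume "Q Y \<le> Q y"
  show "Y \<le> y"
  proof (rule ccontr)
    assume "\<not> Y \<le> y"
    then consider "\<bar>y\<bar> < Y" | "y \<le> - Y" by linarith
    then show False
    proof cases
      case 2
      then have "Q Y \<le> Q (- y)" using Q_strict[of Y "- y"] by (cases "Y = - y") auto
      then show False using Q_odd[of y] QY_pos \<open>Q Y \<le> Q y\<close> by simp
    qed (use Q_inner \<open>Q Y \<le> Q y\<close> in force)
  qed
qed (use Q_strict[of Y y] in \<open>cases "Y = y"; simp\<close>)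

lemma Q_le_iff: "Q y \<le> - Q Y \<longleftrightarrow> y \<le> - Y"
  using Q_ge_iff[of "- y"] Q_odd[of y] by auto

lemma Q_abs_ge_iff: "Q Y \<le> \<bar>Q y\<bar> \<longleftrightarrow> Y \<le> \<bar>y\<bar>"
  using Q_ge_iff[of y] Q_le_iff[of y] QY_pos Y by linarith

lemma Q_abs_le_iff: "\<bar>Q y\<bar> \<le> Q Y \<longleftrightarrow> \<bar>y\<bar> \<le> Y"
proof -
  have "\<bar>Q y\<bar> = \<bar>Q \<bar>y\<bar>\<bar>" using Q_odd[of y] by (simp add: abs_if)
  then show ?thesis using Q_inner[of y] Q_strict[of Y "\<bar>y\<bar>"] QY_pos
    by (cases "\<bar>y\<bar>" Y rule: linorder_cases) auto
qed

lemma Q_solve_pos: "\<exists>!y. Q y = v" if "Q Y \<le> v"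
proof -
  \<comment> \<open>At \<open>b\<close> the line of slope \<open>\<kappa>\<close> through
    \<open>(Y, Q Y)\<close> reaches \<open>v\<close>, and \<open>Q\<close> lies above this
    line.\<close>
  define b where "b = Y + (v - Q Y) / \<kappa>"
  have "Y \<le> b" using that \<kappa> by (simp add: b_def)
  moreover have "v \<le> Q b" using Q_growth[of Y b] \<open>Y \<le> b\<close> \<kappa> by (simp add: b_def)
  ultimately have "\<exists>y\<ge>Y. y \<le> b \<and> Q y = v"
    by (intro IVT' Q_cont that)
  then obtain y where y: "Y \<le> y" "Q y = v" by blast
  then have "z = y" if "Q z = v" for z
  proof -
    have "Y \<le> z" using that Q_ge_iff[of z] \<open>Q Y \<le> v\<close> by simp
    then show ?thesis using Q_strict[of y z] Q_strict[of z y] y that by (cases z y rule: linorder_cases) auto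
  qed
  with y show ?thesis by blast
qed

lemma Q_solve: "\<exists>!y. Q y = v" if "Q Y \<le> \<bar>v\<bar>"
proof (cases "v \<ge> 0")
  case True
  then show ?thesis using Q_solve_pos[of v] that by simp
next
  case False
  with that have "\<exists>!y. Q y = - v" by (intro Q_solve_pos) simp
  then obtain y where y: "Q y = - v" "\<forall>z. Q z = - v \<longrightarrow> z = y" by auto
  show ?thesis
  proof (rule ex1I[of _ "- y"])
    show "Q (- y) = v" using y(1) Q_odd[of y] by simp
    show "z = - y" if "Q z = v" for z using y(2)[rule_format, of "- z"] that Q_odd[of z] by simp
  qed
qed

lemma Q_h: "Q (h v) = v" if "Q Y \<le> \<bar>v\<bar>"
  using theI'[OF Q_solve[OF that]] by (simp add: h_def)

lemma h_unique: "y = h v" if "Q Y \<le> \<bar>v\<bar>" "Q y = v"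
  using Q_solve[OF that(1)] Q_h[OF that(1)] that(2) by blast

lemma h_Q: "h (Q y) = y" if "Q Y \<le> \<bar>Q y\<bar>"
  using h_unique[OF that refl] by simp

lemma h_minus: "h (- v) = - h v" if "Q Y \<le> \<bar>v\<bar>"
  using h_unique[of "- v" "- h v"] Q_h[OF that] Q_odd[of "h v"] that by simp

lemma h_QY: "h (Q Y) = Y" "h (- Q Y) = - Y"
  using h_unique[of "Q Y" Y] h_unique[of "- Q Y" "- Y"] Q_odd[of Y] by auto

lemma h_abs_ge: "Y \<le> \<bar>h v\<bar>" if "Q Y \<le> \<bar>v\<bar>"
  using Q_abs_ge_iff[of "h v"] Q_h[OF that] that by simp

text \<open>The lower bound \<open>\<kappa>\<close> for the slope of \<open>Q\<close> becomes the
  Lipschitz constant \<open>1 / \<kappa>\<close> of its inverse.\<close>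

lemma h_lipschitz_pos: "\<bar>h u - h v\<bar> \<le> \<bar>u - v\<bar> / \<kappa>" if "Q Y \<le> u" "Q Y \<le> v"
proof -
  have *: "\<bar>h u - h v\<bar> \<le> \<bar>u - v\<bar> / \<kappa>" if "Q Y \<le> u" "Q Y \<le> v" "h u \<le> h v" for u v
  proof -
    have "Q (h u) = u" "Q (h v) = v" using Q_h that QY_pos by auto
    moreover have "Y \<le> h u" using Q_ge_iff \<open>Q (h u) = u\<close> that by metis
    ultimately have "\<kappa> * (h v - h u) \<le> v - u" using Q_growth[of "h u" "h v"] that by simp
    then show ?thesis using \<kappa> that by (simp add: field_simps abs_if)
  qed
  show ?thesis using *[of u v] *[of v u] that by (cases "h u \<le> h v") (auto simp: abs_minus_commute)
qed

lemma h_continuous_pos: "continuous_on {Q Y..} h"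
proof (rule lipschitz_on_continuous_on)
  show "(1 / \<kappa>)-lipschitz_on {Q Y..} h"
    by (rule lipschitz_onI) (use h_lipschitz_pos \<kappa> in \<open>simp_all add: dist_real_def\<close>)
qed

lemma h_P_continuous:
  assumes "(\<forall>x\<in>J. Q Y \<le> P x) \<or> (\<forall>x\<in>J. P x \<le> - Q Y)"
  shows "continuous_on J (\<lambda>x. h (P x))"
  using assms
proof
  assume "\<forall>x\<in>J. Q Y \<le> P x"
  then show ?thesis by (intro continuous_on_compose2[OF h_continuous_pos P_cont]) auto
next
  assume *: "\<forall>x\<in>J. P x \<le> - Q Y"
  then have "continuous_on J (\<lambda>x. - h (- P x))"
    by (intro continuous_on_minus continuous_on_compose2[OF h_continuous_pos] continuous_intros P_cont) auto
  moreover have "- h (- P x) = h (P x)" if "x \<in> J" for x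
    using h_minus[of "P x"] * that QY_pos by force
  ultimately show ?thesis by (simp cong: continuous_on_cong)
qed

section \<open>Regularity of the level curve and arcs over a single strip\<close>

lemma closed_Z: "closed Z"
proof -
  have "Z = {z. P (fst z) = Q (snd z)}" by (auto simp: Z_def)
  then show ?thesis
    by (auto intro!: closed_Collect_eq continuous_on_compose2[OF P_cont] continuous_on_compose2[OF Q_cont] continuous_intros)
qed

text \<open>At a critical point of \<open>P\<close> the level exceeds \<open>Q Y\<close> in absolute
  value, which forces \<open>Y \<le> \<bar>y\<bar>\<close>, where \<open>Q'\<close> is positive.
  Hence the curve has no singular point.\<close>

lemma V_nonzero: "V z \<noteq> 0" if "z \<in> Z"
proof
  assume V0: "V z = 0"
  from that obtain x y where z: "z = (x, y)" "P x = Q y" by (auto simp: Z_def)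
  then have "P' x = 0" "Q' y = 0" using V0 by (auto simp: V_def zero_prod_def)
  then have "Q Y < \<bar>Q y\<bar>" using P'_nonzero[of x] z by force
  then have "Y \<le> \<bar>y\<bar>" using Q_abs_ge_iff[of y] by simp
  then show False using Q'_outer[of y] \<kappa> \<open>Q' y = 0\<close> by simp
qed

text \<open>Here the curve is the graph of \<open>h (P x)\<close>, whose slope is
  \<open>P' / Q'\<close>; thus \<open>corner\<close> moves with velocity \<open>V\<close> divided by
  the positive number \<open>Q'\<close>. The strip may be unbounded, so either end may be
  absent.\<close>

lemma gap_arc:
  assumes J: "is_interval J" "closed J" "J \<noteq> {}"
    and sgn: "(\<forall>x\<in>J. Q Y \<le> P x) \<or> (\<forall>x\<in>J. P x \<le> - Q Y)"
    and ends: "arc_from J corner w" "arc_to J corner z"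
  shows "flow_arc V w z (Z \<inter> J \<times> UNIV)"
proof -
  have abs: "Q Y \<le> \<bar>P x\<bar>" if "x \<in> J" for x using sgn that by auto
  note cont = h_P_continuous[OF sgn]
  have pos: "Q' (h (P x)) > 0" if "x \<in> J" for x
    using Q'_outer[OF h_abs_ge[OF abs[OF that]]] \<kappa> by simp
  show ?thesis
  proof (rule flow_arc_reparametrize[OF J _ ends, where \<rho> = fst and l = "\<lambda>x. 1 / Q' (h (P x))"])
    show "homeomorphism J (Z \<inter> J \<times> UNIV) corner fst"
    proof (rule homeomorphismI)
      show "continuous_on J corner" unfolding corner_def[abs_def] by (intro continuous_intros cont)
      show "corner ` J \<subseteq> Z \<inter> J \<times> UNIV" using Q_h abs by (auto simp: corner_def Z_def)
      show "corner (fst z) = z" if "z \<in> Z \<inter> J \<times> UNIV" for z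
        using that abs[of "fst z"] by (auto simp: corner_def Z_def h_Q)
    qed (auto intro!: continuous_intros simp: corner_def)
    show "continuous_on J (\<lambda>x. 1 / Q' (h (P x)))"
      using pos by (intro continuous_intros continuous_on_compose2[OF Q'_cont cont]) force+
    show "0 < 1 / Q' (h (P x))" if "x \<in> J" for x using pos[OF that] by simp
    show "(corner has_vector_derivative (1 / Q' (h (P x))) *\<^sub>R V (corner x)) (at x within J)" if "x \<in> J" for x
    proof -
      have "((\<lambda>x. h (P x)) has_real_derivative P' x / Q' (h (P x))) (at x within J)"
        using cont that Q_h abs pos[OF that]
        by (intro has_real_derivative_implicit[where Q = Q and P = P])
          (auto simp: continuous_on_eq_continuous_within intro: Q P has_field_derivative_at_within)
      then have "(corner has_vector_derivative (1, P' x / Q' (h (P x)))) (at x within J)"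
        unfolding corner_def[abs_def]
        by (intro has_vector_derivative_Pair) (auto simp: has_real_derivative_iff_has_vector_derivative)
      then show ?thesis using pos[OF that] by (simp add: V_def corner_def)
    qed
  qed
qed

text \<open>On the strip \<open>P'\<close> has no zero, hence one sign. The sign \<open>e\<close>
  treats increasing and decreasing \<open>P\<close> together.\<close>

lemma monotone_stretch:
  assumes "p < q" and le: "\<forall>x\<in>{p..q}. \<bar>P x\<bar> \<le> Q Y" and "\<bar>P p\<bar> = Q Y" "\<bar>P q\<bar> = Q Y"
  shows "\<exists>e::real. (e = 1 \<or> e = -1) \<and> (\<forall>x\<in>{p..q}. e * P' x > 0) \<and>
    (\<forall>x y. p \<le> x \<longrightarrow> x < y \<longrightarrow> y \<le> q \<longrightarrow> e * P x < e * P y) \<and> e * P p = - Q Y \<and> e * P q = Q Y"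
proof -
  have "(\<forall>x\<in>{p..q}. P' x > 0) \<or> (\<forall>x\<in>{p..q}. P' x < 0)"
    by (rule connected_nonzero_sign) (use P'_nonzero le in \<open>auto intro: continuous_on_subset[OF P'_cont]\<close>)
  then have "(\<forall>x\<in>{p..q}. 1 * P' x > 0) \<or> (\<forall>x\<in>{p..q}. -1 * P' x > 0)" by simp
  then obtain e :: real where e: "e = 1 \<or> e = -1" "\<forall>x\<in>{p..q}. e * P' x > 0" by blast
  have mono: "e * P x < e * P y" if "p \<le> x" "x < y" "y \<le> q" for x y
  proof (rule DERIV_pos_imp_increasing[OF \<open>x < y\<close>])
    fix u assume "x \<le> u" "u \<le> y"
    then show "\<exists>d. ((\<lambda>x. e * P x) has_real_derivative d) (at u) \<and> d > 0"
      using e(2) that DERIV_cmult[OF P, of e u] by (intro exI[of _ "e * P' u"]) auto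
  qed
  \<comment> \<open>Both values are \<open>Q Y\<close> up to sign, and the one at \<open>p\<close>
    is strictly smaller.\<close>
  have "e * P p = - Q Y" "e * P q = Q Y"
    using mono[of p q] \<open>p < q\<close> assms(3,4) e(1) by (auto simp: abs_if split: if_splits)
  then show ?thesis using e mono by auto
qed

text \<open>The strip is crossed with \<open>x\<close> increasing, so \<open>y\<close> rises if
  \<open>P\<close> increases and falls if \<open>P\<close> decreases. The parameter is
  \<open>t = e * y\<close>, and \<open>x\<close> is found by inverting \<open>e * P\<close> on the
  strip.\<close>

lemma column_arc:
  assumes "p < q" and le: "\<forall>x\<in>{p..q}. \<bar>P x\<bar> \<le> Q Y" and "\<bar>P p\<bar> = Q Y" "\<bar>P q\<bar> = Q Y"
  shows "flow_arc V (Some (corner p)) (Some (corner q)) (Z \<inter> {p..q} \<times> UNIV)"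
proof -
  obtain e :: real where e: "e = 1 \<or> e = -1" "\<forall>x\<in>{p..q}. e * P' x > 0"
    "\<forall>x y. p \<le> x \<longrightarrow> x < y \<longrightarrow> y \<le> q \<longrightarrow> e * P x < e * P y"
    "e * P p = - Q Y" "e * P q = Q Y"
    using monotone_stretch[OF assms] by blast
  have ee: "e * e = 1" "e * (e * x) = x" for x using e(1) by auto
  have Qe: "Q (e * y) = e * Q y" for y using e(1) Q_odd[of y] by auto
  have Q'e: "Q' (e * y) = Q' y" for y using e(1) Q'_even[of y] by auto
  have ab: "\<bar>e * y\<bar> = \<bar>y\<bar>" for y using e(1) by auto
  define P1 where "P1 x = e * P x" for x
  have inj: "inj_on P1 {p..q}"
    by (rule linorder_inj_onI') (use e(3) in \<open>force simp: P1_def\<close>)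
  have P1c: "continuous_on {p..q} P1" unfolding P1_def by (intro continuous_intros P_cont)
  have im: "P1 ` {p..q} = {- Q Y..Q Y}"
  proof
    show "P1 ` {p..q} \<subseteq> {- Q Y..Q Y}"
    proof (rule image_subsetI)
      fix x assume "x \<in> {p..q}"
      then have "\<bar>e * P x\<bar> \<le> Q Y" using le ab[of "P x"] by simp
      then show "P1 x \<in> {- Q Y..Q Y}" by (simp add: P1_def abs_le_iff)
    qed
    show "{- Q Y..Q Y} \<subseteq> P1 ` {p..q}"
    proof
      fix v assume "v \<in> {- Q Y..Q Y}"
      then have "\<exists>x\<ge>p. x \<le> q \<and> P1 x = v"
        using e(4,5) \<open>p < q\<close> by (intro IVT' P1c) (auto simp: P1_def)
      then show "v \<in> P1 ` {p..q}" by auto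
    qed
  qed
  obtain k where k: "homeomorphism {p..q} {- Q Y..Q Y} P1 k"
    using homeomorphism_into_1d[OF _ P1c im inj] by auto
  have Qin: "Q t \<in> {- Q Y..Q Y}" if "t \<in> {-Y..Y}" for t using Q_abs_le_iff[of t] that by auto
  have kin: "k (Q t) \<in> {p..q}" "P1 (k (Q t)) = Q t" if "t \<in> {-Y..Y}" for t
  proof -
    from Qin[OF that] show "k (Q t) \<in> {p..q}" "P1 (k (Q t)) = Q t" using k by (auto simp: homeomorphism_def)
  qed
  have kQc: "continuous_on {-Y..Y} (\<lambda>t. k (Q t))"
    by (rule continuous_on_compose2[OF homeomorphism_cont2[OF k] Q_cont]) (rule image_subsetI, rule Qin)
  \<comment> \<open>On the curve since \<open>e * P x = Q t\<close> means
    \<open>P x = e * Q t = Q (e * t)\<close>, by oddness of \<open>Q\<close> and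
    \<open>e * e = 1\<close>.\<close>
  define \<sigma> where "\<sigma> t = (k (Q t), e * t)" for t
  have \<sigma>p: "\<sigma> (- Y) = corner p" and \<sigma>q: "\<sigma> Y = corner q"
  proof -
    have "k (P1 p) = p" "k (P1 q) = q" using k \<open>p < q\<close> by (auto simp: homeomorphism_def)
    then have k': "k (- Q Y) = p" "k (Q Y) = q" using e(4,5) by (auto simp: P1_def)
    have "P p = - (e * Q Y)" "P q = e * Q Y" using e(4,5) ee(2)[of "P p"] ee(2)[of "P q"] by simp_all
    then show "\<sigma> (- Y) = corner p" "\<sigma> Y = corner q"
      using e(1) k' h_QY Q_odd[of Y] by (auto simp: \<sigma>_def corner_def)
  qed
  show ?thesis
  proof (rule flow_arc_reparametrize[where J = "{-Y..Y}" and \<sigma> = \<sigma> and \<rho> = "\<lambda>z. e * snd z" and l = "\<lambda>t. 1 / (e * P' (k (Q t)))"])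
    show "homeomorphism {-Y..Y} (Z \<inter> {p..q} \<times> UNIV) \<sigma> (\<lambda>z. e * snd z)"
    proof (rule homeomorphismI)
      show "continuous_on {-Y..Y} \<sigma>" unfolding \<sigma>_def by (intro continuous_intros kQc)
      show "continuous_on (Z \<inter> {p..q} \<times> UNIV) (\<lambda>z. e * snd z)" by (intro continuous_intros)
      show "\<sigma> ` {-Y..Y} \<subseteq> Z \<inter> {p..q} \<times> UNIV"
      proof (rule image_subsetI)
        fix t assume "t \<in> {-Y..Y}"
        note * = kin[OF this]
        have "P (k (Q t)) = e * P1 (k (Q t))" by (simp add: P1_def ee)
        then show "\<sigma> t \<in> Z \<inter> {p..q} \<times> UNIV" using * by (simp add: \<sigma>_def Z_def Qe)
      qed
      have *: "\<bar>y\<bar> \<le> Y" "k (e * Q y) = x" if "x \<in> {p..q}" "P x = Q y" for x y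
      proof -
        have "\<bar>Q y\<bar> \<le> Q Y" using le that by metis
        then show "\<bar>y\<bar> \<le> Y" using Q_abs_le_iff[of y] by simp
        show "k (e * Q y) = x" using homeomorphism_apply1[OF k that(1)] that(2) by (simp add: P1_def)
      qed
      show "(\<lambda>z. e * snd z) ` (Z \<inter> {p..q} \<times> UNIV) \<subseteq> {-Y..Y}"
      proof (rule image_subsetI)
        fix z assume "z \<in> Z \<inter> {p..q} \<times> UNIV"
        then have "\<bar>e * snd z\<bar> \<le> Y" using *(1)[of "fst z" "snd z"] ab[of "snd z"] by (auto simp: Z_def)
        then show "e * snd z \<in> {-Y..Y}" by (simp add: abs_le_iff)
      qed
      show "\<sigma> (e * snd z) = z" if "z \<in> Z \<inter> {p..q} \<times> UNIV" for z
        using that *(2) by (auto simp: \<sigma>_def Z_def ee Qe)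
      show "e * snd (\<sigma> t) = t" for t by (simp add: \<sigma>_def ee)
    qed
    show "continuous_on {-Y..Y} (\<lambda>t. 1 / (e * P' (k (Q t))))"
      using e(2) kin(1) by (intro continuous_intros continuous_on_compose2[OF P'_cont kQc]) force+
    show "0 < 1 / (e * P' (k (Q t)))" if "t \<in> {-Y..Y}" for t
      using e(2) kin(1)[OF that] by simp
    show "arc_from {-Y..Y} \<sigma> (Some (corner p))" "arc_to {-Y..Y} \<sigma> (Some (corner q))"
      using \<sigma>p \<sigma>q Y by (auto simp: arc_from_def arc_to_def)
    show "(\<sigma> has_vector_derivative (1 / (e * P' (k (Q t)))) *\<^sub>R V (\<sigma> t)) (at t within {-Y..Y})"
      if t: "t \<in> {-Y..Y}" for t
    proof -
      have pos: "e * P' (k (Q t)) > 0" using e(2) kin(1)[OF t] by simp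
      have "((\<lambda>t. k (Q t)) has_real_derivative Q' t / (e * P' (k (Q t)))) (at t within {-Y..Y})"
      proof (rule has_real_derivative_implicit[where Q = P1 and P = Q])
        show "continuous (at t within {-Y..Y}) (\<lambda>t. k (Q t))"
          using kQc t by (simp add: continuous_on_eq_continuous_within)
        show "(P1 has_real_derivative e * P' (k (Q t))) (at (k (Q t)))"
          unfolding P1_def by (rule DERIV_cmult[OF P])
      qed (use kin t pos in \<open>auto intro: has_field_derivative_at_within Q\<close>)
      moreover have "((\<lambda>t. e * t) has_real_derivative e) (at t within {-Y..Y})"
        by (auto intro!: derivative_eq_intros)
      ultimately have "(\<sigma> has_vector_derivative (Q' t / (e * P' (k (Q t))), e)) (at t within {-Y..Y})"
        unfolding \<sigma>_def[abs_def]
        by (intro has_vector_derivative_Pair) (simp_all add: has_real_derivative_iff_has_vector_derivative)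
      \<comment> \<open>Uses that \<open>Q'\<close> is even and that \<open>e\<close> is its own
        reciprocal.\<close>
      moreover have "(Q' t / (e * P' (k (Q t))), e) = (1 / (e * P' (k (Q t)))) *\<^sub>R V (\<sigma> t)"
        using pos e(1) by (auto simp: V_def \<sigma>_def Q'e)
      ultimately show ?thesis by simp
    qed
  qed (use Y in auto)
qed

section \<open>Joining the strips from left to right\<close>

abbreviation "B \<equiv> {x. \<bar>P x\<bar> = Q Y}"

lemma off_B_sign:
  assumes "connected S" "S \<inter> B = {}"
  shows "(\<forall>x\<in>S. Q Y < \<bar>P x\<bar>) \<or> (\<forall>x\<in>S. \<bar>P x\<bar> < Q Y)"
proof -
  have "continuous_on S (\<lambda>x. \<bar>P x\<bar> - Q Y)" by (intro continuous_intros P_cont)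
  moreover have "\<forall>x\<in>S. \<bar>P x\<bar> - Q Y \<noteq> 0" using assms(2) by auto
  ultimately have "(\<forall>x\<in>S. 0 < \<bar>P x\<bar> - Q Y) \<or> (\<forall>x\<in>S. \<bar>P x\<bar> - Q Y < 0)"
    by (rule connected_nonzero_sign[OF assms(1)])
  then show ?thesis by simp
qed

text \<open>Passing from one sign to the other would take \<open>P\<close> through 0, which is below
  \<open>Q Y\<close> in absolute value.\<close>

lemma outside_sign:
  assumes "connected J" "\<forall>x\<in>J. Q Y \<le> \<bar>P x\<bar>"
  shows "(\<forall>x\<in>J. Q Y \<le> P x) \<or> (\<forall>x\<in>J. P x \<le> - Q Y)"
proof -
  have "\<forall>x\<in>J. P x \<noteq> 0" using assms(2) QY_pos by force
  from connected_nonzero_sign[OF assms(1) P_cont this] show ?thesis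
    using assms(2) by (metis abs_of_neg abs_of_pos le_minus_iff)
qed

text \<open>Between neighbouring cuts \<open>\<bar>P\<bar>\<close> stays on one side of
  \<open>Q Y\<close>, which decides whether the piece is a graph over \<open>x\<close> or over
  \<open>y\<close>.\<close>

lemma stretch_arc:
  assumes "p < q" "p \<in> B" "q \<in> B" "{p<..<q} \<inter> B = {}"
  shows "flow_arc V (Some (corner p)) (Some (corner q)) (Z \<inter> {p..q} \<times> UNIV)"
proof -
  have ends: "x = p \<or> x = q \<or> x \<in> {p<..<q}" if "p \<le> x" "x \<le> q" for x using that by auto
  from off_B_sign[OF connected_Ioo assms(4)] show ?thesis
  proof
    assume out: "\<forall>x\<in>{p<..<q}. Q Y < \<bar>P x\<bar>"
    have "\<forall>x\<in>{p..q}. Q Y \<le> \<bar>P x\<bar>"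
      using ends assms(2,3) out by fastforce
    from outside_sign[OF connected_Icc this] show ?thesis
      using \<open>p < q\<close> by (intro gap_arc) (auto simp: arc_from_def arc_to_def)
  next
    assume inn: "\<forall>x\<in>{p<..<q}. \<bar>P x\<bar> < Q Y"
    then have "\<forall>x\<in>{p..q}. \<bar>P x\<bar> \<le> Q Y" using ends assms(2,3) by fastforce
    then show ?thesis using assms(1-3) by (intro column_arc) auto
  qed
qed

lemma Z_corner: "(x, y) = corner x" if "x \<in> B" "(x, y) \<in> Z"
proof -
  have "P x = Q y" "\<bar>P x\<bar> = Q Y" using that by (auto simp: Z_def)
  then show ?thesis using h_Q[of y] by (simp add: corner_def)
qed

lemma closed_Z_strip: "closed (Z \<inter> J \<times> UNIV)" if "closed J"
  using that by (intro closed_Int closed_Z closed_Times) auto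

lemma left_unbounded: "\<exists>x<q. Q Y < \<bar>P x\<bar>" and right_unbounded: "\<exists>x>q. Q Y < \<bar>P x\<bar>"
proof -
  obtain r where r: "\<And>x. r \<le> \<bar>x\<bar> \<Longrightarrow> Q Y < \<bar>P x\<bar>" using P_large by blast
  show "\<exists>x<q. Q Y < \<bar>P x\<bar>" using r[of "min (q - 1) (- \<bar>r\<bar>)"] by (intro exI[of _ "min (q - 1) (- \<bar>r\<bar>)"]) auto
  show "\<exists>x>q. Q Y < \<bar>P x\<bar>" using r[of "max (q + 1) \<bar>r\<bar>"] by (intro exI[of _ "max (q + 1) \<bar>r\<bar>"]) auto
qed

text \<open>Induction on the number of cuts to the left of \<open>q\<close>. With none, the strip
  reaches to minus infinity, where \<open>\<bar>P\<bar>\<close> is large, so it is a graph over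
  \<open>x\<close>; otherwise the strip from the last cut before \<open>q\<close> is
  appended.\<close>

lemma left_arc:
  assumes "q \<in> B"
  shows "flow_arc V None (Some (corner q)) (Z \<inter> {..q} \<times> UNIV)"
  using assms
proof (induction "card {p \<in> B. p < q}" arbitrary: q rule: less_induct)
  case less
  show ?case
  proof (cases "{p \<in> B. p < q} = {}")
    case True
    then have "{..<q} \<inter> B = {}" by auto
    from off_B_sign[OF connected_Iio this] left_unbounded[of q] have "\<forall>x\<in>{..<q}. Q Y < \<bar>P x\<bar>" by force
    then have "\<forall>x\<in>{..q}. Q Y \<le> \<bar>P x\<bar>"
      using less.prems by (auto simp: le_less)
    note sgn = outside_sign[OF connected_Iic this]
    have "\<exists>u\<in>{..q}. u < t" if "t \<in> {..q}" for t using that by (intro bexI[of _ "t - 1"]) auto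
    then have "arc_from {..q} corner None" unfolding arc_from_def option.case ..
    then show ?thesis by (intro gap_arc sgn) (auto simp: arc_to_def)
  next
    case False
    define p where "p = Max {p \<in> B. p < q}"
    have fin: "finite {p \<in> B. p < q}" using P_finite by simp
    have p: "p \<in> B" "p < q" using Max_in[OF fin False] by (auto simp: p_def)
    have max: "x \<le> p" if "x \<in> B" "x < q" for x using Max_ge[OF fin, of x] that by (simp add: p_def)
    have "{x \<in> B. x < p} \<subset> {x \<in> B. x < q}" using p by auto
    then have 1: "flow_arc V None (Some (corner p)) (Z \<inter> {..p} \<times> UNIV)"
      using less.hyps[of p] p(1) psubset_card_mono[OF fin] by blast
    have 2: "flow_arc V (Some (corner p)) (Some (corner q)) (Z \<inter> {p..q} \<times> UNIV)"
      using max p less.prems by (intro stretch_arc) (auto, force)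
    have "flow_arc V None (Some (corner q)) (Z \<inter> {..p} \<times> UNIV \<union> Z \<inter> {p..q} \<times> UNIV)"
    proof (rule flow_arc_join[OF 1 2])
      show "Z \<inter> {..p} \<times> UNIV \<inter> (Z \<inter> {p..q} \<times> UNIV) \<subseteq> {corner p}"
        using Z_corner p(1) by (auto dest!: antisym)
    qed (simp_all add: closed_Z_strip)
    moreover have "Z \<inter> {..p} \<times> UNIV \<union> Z \<inter> {p..q} \<times> UNIV = Z \<inter> {..q} \<times> UNIV"
      using p(2) by auto
    ultimately show ?thesis by simp
  qed
qed

text \<open>The arc up to the last cut \<open>m\<close> is completed by the graph over the unbounded
  strip to its right, so neither end is present.\<close>

lemma Z_arc: "flow_arc V None None Z"
proof -
  define m where "m = Max B"
  have ne: "B \<noteq> {}" using P_attains by auto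
  have m: "m \<in> B" using Max_in[OF P_finite ne] by (simp add: m_def)
  have max: "x \<le> m" if "x \<in> B" for x using Max_ge[OF P_finite that] by (simp add: m_def)
  have "{m<..} \<inter> B = {}" using max by fastforce
  from off_B_sign[OF connected_Ioi this] right_unbounded[of m] have "\<forall>x\<in>{m<..}. Q Y < \<bar>P x\<bar>" by force
  then have "\<forall>x\<in>{m..}. Q Y \<le> \<bar>P x\<bar>"
    using m by (auto simp: le_less)
  note sgn = outside_sign[OF connected_Ici this]
  have "\<exists>u\<in>{m..}. t < u" if "t \<in> {m..}" for t using that by (intro bexI[of _ "t + 1"]) auto
  then have "arc_to {m..} corner None" unfolding arc_to_def option.case ..
  then have "flow_arc V (Some (corner m)) None (Z \<inter> {m..} \<times> UNIV)"
    by (intro gap_arc sgn) (auto simp: arc_from_def)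
  then have "flow_arc V None None (Z \<inter> {..m} \<times> UNIV \<union> Z \<inter> {m..} \<times> UNIV)"
  proof (rule flow_arc_join[OF left_arc[OF m]])
    show "Z \<inter> {..m} \<times> UNIV \<inter> (Z \<inter> {m..} \<times> UNIV) \<subseteq> {corner m}"
      using Z_corner m by (auto dest!: antisym)
  qed (simp_all add: closed_Z_strip)
  moreover have "Z \<inter> {..m} \<times> UNIV \<union> Z \<inter> {m..} \<times> UNIV = Z" by auto
  ultimately show ?thesis by simp
qed

end

section \<open>The two sides of the level curve\<close>

lemma components_Un_open:
  fixes A B :: "'a::topological_space set"
  assumes "open A" "open B" "connected A" "connected B" "A \<inter> B = {}" "A \<noteq> {}" "B \<noteq> {}"
  shows "components (A \<union> B) = {A, B}"
proof -
  have sub: "D \<subseteq> A \<or> D \<subseteq> B" if "connected D" "D \<subseteq> A \<union> B" for D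
    using connectedD[OF that(1) assms(1,2)] that(2) assms(5) by blast
  have "A \<in> components (A \<union> B)" "B \<in> components (A \<union> B)"
    unfolding in_components_maximal using assms sub by blast+
  moreover have "C = A \<or> C = B" if C: "C \<in> components (A \<union> B)" for C
    using sub[of C] in_components_connected[OF C] in_components_subset[OF C] in_components_nonempty[OF C]
      components_eq[OF C] calculation assms(5) by (metis inf.absorb_iff1 inf_assoc inf_bot_right)
  ultimately show ?thesis by blast
qed

context separated_level_curve
begin

definition "upper_side = {(x, y). P x < Q y}"
text \<open>The part of \<open>upper_side\<close> above \<open>y = Y\<close>, written as the region
  above a continuous graph; the maximum keeps the argument of \<open>h\<close> where
  \<open>h\<close> inverts \<open>Q\<close>.\<close>

definition "top_region = {(x, y). h (max (P x) (Q Y)) < y}"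

lemma Q_less_iff: "Q y < Q z \<longleftrightarrow> y < z" if "Y \<le> y" "Y \<le> z"
  using Q_strict[of y z] Q_strict[of z y] that by (cases y z rule: linorder_cases) auto

lemma top_region_iff: "(x, y) \<in> top_region \<longleftrightarrow> Y < y \<and> P x < Q y"
proof -
  let ?v = "max (P x) (Q Y)"
  have "Q Y \<le> \<bar>?v\<bar>" using QY_pos by auto
  note v = Q_h[OF this] h_abs_ge[OF this]
  have *: "Y \<le> h ?v" using Q_ge_iff[of "h ?v"] v by simp
  show ?thesis
  proof
    assume "(x, y) \<in> top_region"
    then have "h ?v < y" by (simp add: top_region_def)
    then show "Y < y \<and> P x < Q y" using * Q_less_iff[of "h ?v" y] v by simp
  next
    assume "Y < y \<and> P x < Q y"
    then have "Q (h ?v) < Q y" using v Q_strict[of Y y] by simp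
    then show "(x, y) \<in> top_region" using Q_less_iff[of "h ?v" y] * \<open>Y < y \<and> P x < Q y\<close>
      by (simp add: top_region_def)
  qed
qed

text \<open>A vertical shear along the bounding graph carries an open half plane onto the
  region.\<close>

lemma connected_top_region: "connected top_region"
proof -
  define F where "F = (\<lambda>z. (fst z, h (max (P (fst z)) (Q Y)) + snd z))"
  have "continuous_on UNIV (\<lambda>x. h (max (P x) (Q Y)))"
    by (rule continuous_on_compose2[OF h_continuous_pos])
      (auto intro!: continuous_on_max P_cont continuous_intros)
  then have "continuous_on (UNIV \<times> {0<..}) F"
    unfolding F_def by (intro continuous_intros continuous_on_compose2[of UNIV _ _ fst]) auto
  moreover have "connected ((UNIV :: real set) \<times> {0::real<..})"
    by (intro connected_Times) auto
  ultimately have "connected (F ` (UNIV \<times> {0<..}))" by (rule connected_continuous_image)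
  moreover have "F ` (UNIV \<times> {0<..}) = top_region"
  proof
    show "top_region \<subseteq> F ` (UNIV \<times> {0<..})"
    proof
      fix z assume "z \<in> top_region"
      then show "z \<in> F ` (UNIV \<times> {0<..})"
        by (intro image_eqI[of _ _ "(fst z, snd z - h (max (P (fst z)) (Q Y)))"])
          (auto simp: F_def top_region_def)
    qed
  qed (auto simp: F_def top_region_def)
  ultimately show ?thesis by simp
qed

text \<open>Moving up, \<open>Q\<close> increases until \<open>- Y\<close>, then stays above
  \<open>- Q Y\<close> between \<open>- Y\<close> and \<open>Y\<close>, and is positive from
  \<open>Y\<close> on.\<close>

lemma vertical_in_upper_side:
  assumes "P x \<le> - Q Y" "P x < Q y" "y \<le> z"
  shows "P x < Q z"
proof -
  consider "z \<le> - Y" | "\<bar>z\<bar> < Y" | "Y \<le> z" by linarith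
  then show ?thesis
  proof cases
    case 1
    then have "Q y \<le> Q z"
      using Q_strict[of "- z" "- y"] Q_odd[of y] Q_odd[of z] assms(3) by (cases "y = z") auto
    then show ?thesis using assms by simp
  next
    case 2
    then show ?thesis using Q_inner[of z] assms by simp
  next
    case 3
    then show ?thesis using Q_ge_iff[of z] QY_pos assms by simp
  qed
qed

lemma vertical_connection:
  assumes "P x \<le> - Q Y" "P x < Q y"
  shows "\<exists>S. connected S \<and> S \<subseteq> upper_side \<and> (x, y) \<in> S \<and> S \<inter> top_region \<noteq> {}"
proof (intro exI conjI)
  show "connected ({x} \<times> {y..})" by (intro connected_Times) auto
  show "{x} \<times> {y..} \<subseteq> upper_side" using vertical_in_upper_side[OF assms] by (auto simp: upper_side_def)
  define b where "b = max y (Y + 1)"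
  have "Y < b" "y \<le> b" by (auto simp: b_def)
  then have "(x, b) \<in> top_region" "(x, b) \<in> {x} \<times> {y..}"
    using vertical_in_upper_side[OF assms] by (auto simp: top_region_iff)
  then show "{x} \<times> {y..} \<inter> top_region \<noteq> {}" by blast
qed simp

text \<open>Take the nearest cuts on both sides; they exist because \<open>\<bar>P\<bar>\<close>
  exceeds \<open>Q Y\<close> somewhere to the left and somewhere to the right.\<close>

lemma stretch_around:
  assumes "\<bar>P x\<bar> < Q Y"
  obtains p q where "p < x" "x < q" "\<bar>P p\<bar> = Q Y" "\<bar>P q\<bar> = Q Y" "\<forall>u\<in>{p..q}. \<bar>P u\<bar> \<le> Q Y"
proof -
  have xB: "x \<notin> B" using assms by simp
  have "{..x} \<inter> B \<noteq> {}"
  proof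
    assume "{..x} \<inter> B = {}"
    note sgn = off_B_sign[OF connected_Iic this]
    obtain u where "u < x" "Q Y < \<bar>P u\<bar>" using left_unbounded by blast
    with sgn assms show False by (auto dest: bspec[of _ _ u] bspec[of _ _ x])
  qed
  then obtain b where "b \<in> B" "b \<le> x" by blast
  with xB have "b \<in> {b \<in> B. b < x}" by (cases "b = x") auto
  then have l: "{b \<in> B. b < x} \<noteq> {}" by blast
  have "{x..} \<inter> B \<noteq> {}"
  proof
    assume "{x..} \<inter> B = {}"
    note sgn = off_B_sign[OF connected_Ici this]
    obtain u where "x < u" "Q Y < \<bar>P u\<bar>" using right_unbounded by blast
    with sgn assms show False by (auto dest: bspec[of _ _ u] bspec[of _ _ x])
  qed
  then obtain c where "c \<in> B" "x \<le> c" by blast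
  with xB have "c \<in> {b \<in> B. x < b}" by (cases "c = x") auto
  then have r: "{b \<in> B. x < b} \<noteq> {}" by blast
  define p q where "p = Max {b \<in> B. b < x}" and "q = Min {b \<in> B. x < b}"
  have fin: "finite {b \<in> B. b < x}" "finite {b \<in> B. x < b}" using P_finite by auto
  have p: "p \<in> B" "p < x" using Max_in[OF fin(1) l] by (auto simp: p_def)
  have q: "q \<in> B" "x < q" using Min_in[OF fin(2) r] by (auto simp: q_def)
  have "b \<notin> {p<..<q}" if "b \<in> B" for b
    using Max_ge[OF fin(1), of b] Min_le[OF fin(2), of b] that xB unfolding p_def q_def
    by (cases b x rule: linorder_cases) auto
  then have "{p<..<q} \<inter> B = {}" by blast
  from off_B_sign[OF connected_Ioo this] p q assms have *: "\<forall>u\<in>{p<..<q}. \<bar>P u\<bar> < Q Y"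
    by (auto dest: bspec[of _ _ x])
  have "\<bar>P u\<bar> \<le> Q Y" if "u \<in> {p..q}" for u
  proof -
    from that consider "u = p" | "u = q" | "u \<in> {p<..<q}" by force
    then show ?thesis using p q * by cases (auto intro: less_imp_le)
  qed
  then show thesis using that[of p q] p q by simp
qed

lemma upper_side_connection:
  assumes "(x, y) \<in> upper_side"
  shows "\<exists>S. connected S \<and> S \<subseteq> upper_side \<and> (x, y) \<in> S \<and> S \<inter> top_region \<noteq> {}"
proof -
  have xy: "P x < Q y" using assms by (simp add: upper_side_def)
  consider "Y < y" | "P x \<le> - Q Y" | "y \<le> Y" "- Q Y < P x" by linarith
  then show ?thesis
  proof cases
    case 1
    then show ?thesis using xy by (intro exI[of _ "{(x, y)}"]) (auto simp: upper_side_def top_region_iff)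
  next
    case 2
    then show ?thesis using vertical_connection xy by blast
  next
    case 3
    \<comment> \<open>Then \<open>- Q Y < P x < Q y \<le> Q Y\<close>, so \<open>x\<close> lies
      inside a strip on which \<open>P\<close> is monotone.\<close>
    have "Q y \<le> Q Y" using 3(1) Q_strict[of y Y] Q_ge_iff[of y] by (cases "y = Y") auto
    then have "\<bar>P x\<bar> < Q Y" using 3 xy by simp
    then obtain p q where pq: "p < x" "x < q" "\<bar>P p\<bar> = Q Y" "\<bar>P q\<bar> = Q Y" "\<forall>u\<in>{p..q}. \<bar>P u\<bar> \<le> Q Y"
      by (rule stretch_around)
    have "p < q" using pq by simp
    obtain e :: real where e: "e = 1 \<or> e = -1"
      "\<forall>u v. p \<le> u \<longrightarrow> u < v \<longrightarrow> v \<le> q \<longrightarrow> e * P u < e * P v" "e * P p = - Q Y" "e * P q = Q Y"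
      using monotone_stretch[OF \<open>p < q\<close> pq(5,3,4)] by blast
    \<comment> \<open>The end \<open>x'\<close> is \<open>p\<close> for increasing and
      \<open>q\<close> for decreasing \<open>P\<close>. On the way \<open>P\<close> stays at most
      \<open>P x\<close>, so the segment at height \<open>y\<close> remains in
      \<open>upper_side\<close>.\<close>
    obtain x' J where x': "P x' = - Q Y" "connected J" "x \<in> J" "x' \<in> J" "\<forall>u\<in>J. P u \<le> P x"
    proof (cases "e = 1")
      case True
      have "P u \<le> P x" if "u \<in> {p..x}" for u
        using e(2)[rule_format, of u x] that pq True by (cases "u = x") auto
      then show thesis using that[of p "{p..x}"] pq e True by simp
    next
      case False
      then have "e = -1" using e by simp
      have "P u \<le> P x" if "u \<in> {x..q}" for u
        using e(2)[rule_format, of x u] that pq \<open>e = -1\<close> by (cases "u = x") auto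
      then show thesis using that[of q "{x..q}"] pq e \<open>e = -1\<close> by simp
    qed
    have "P x' < Q y" using x' xy by force
    then obtain S where S: "connected S" "S \<subseteq> upper_side" "(x', y) \<in> S" "S \<inter> top_region \<noteq> {}"
      using vertical_connection[of x' y] x'(1) by auto
    have "connected (J \<times> {y})" by (intro connected_Times x') simp
    then have "connected (J \<times> {y} \<union> S)" using S x' by (intro connected_Un) auto
    moreover have "J \<times> {y} \<subseteq> upper_side" using x' xy by (force simp: upper_side_def)
    ultimately show ?thesis using S x' by (intro exI[of _ "J \<times> {y} \<union> S"]) auto
  qed
qed

lemma top_region_subset: "top_region \<subseteq> upper_side"
  by (rule subrelI) (simp add: top_region_iff upper_side_def)

lemma top_region_nonempty: "top_region \<noteq> {}"
proof -
  have "(0, h (max (P 0) (Q Y)) + 1) \<in> top_region" by (simp add: top_region_def)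
  then show ?thesis by blast
qed

lemma connected_upper_side: "connected upper_side"
proof -
  \<comment> \<open>Requiring each member to contain \<open>top_region\<close> gives the family a
    common point, so its union is connected.\<close>
  let ?F = "{S. connected S \<and> S \<subseteq> upper_side \<and> top_region \<subseteq> S}"
  have "upper_side \<subseteq> \<Union> ?F"
  proof (rule subrelI)
    fix x y assume "(x, y) \<in> upper_side"
    from upper_side_connection[OF this]
    obtain S where S: "connected S" "S \<subseteq> upper_side" "(x, y) \<in> S" "S \<inter> top_region \<noteq> {}"
      by blast
    then have "S \<union> top_region \<in> ?F"
      using connected_Un[OF S(1) connected_top_region S(4)] top_region_subset by simp
    moreover have "(x, y) \<in> S \<union> top_region" using S(3) by simp
    ultimately show "(x, y) \<in> \<Union> ?F" by (rule UnionI)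
  qed
  moreover have "\<Union> ?F \<subseteq> upper_side" by (rule Union_least) simp
  ultimately have "upper_side = \<Union> ?F" by (rule equalityI)
  moreover have "connected (\<Union> ?F)"
  proof (rule connected_Union)
    have "top_region \<subseteq> \<Inter> ?F" by (rule Inter_greatest) simp
    then show "\<Inter> ?F \<noteq> {}" using top_region_nonempty by (metis subset_empty)
  qed simp
  ultimately show ?thesis by simp
qed

lemma open_upper_side: "open upper_side"
proof -
  have "upper_side = {z. P (fst z) < Q (snd z)}" by (auto simp: upper_side_def)
  then show ?thesis
    by (auto intro!: open_Collect_less continuous_on_compose2[OF P_cont] continuous_on_compose2[OF Q_cont] continuous_intros)
qed

definition "lower_side = {(x, y). Q y < P x}"

text \<open>The locale is invariant under negating \<open>P\<close>. By oddness of \<open>Q\<close>,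
  the map \<open>(x, y)\<close> to \<open>(x, - y)\<close> carries the upper side for
  \<open>- P\<close> onto the lower side for \<open>P\<close>.\<close>

lemma lower_side: "open lower_side" "connected lower_side" "lower_side \<noteq> {}"
proof -
  interpret refl: separated_level_curve "\<lambda>x. - P x" "\<lambda>x. - P' x" Q Q' Y \<kappa>
  proof
    show "((\<lambda>x. - P x) has_real_derivative - P' x) (at x)" for x by (rule DERIV_minus[OF P])
    show "continuous_on UNIV (\<lambda>x. - P' x)" by (intro continuous_intros P'_cont)
    show "\<bar>- P x\<bar> \<le> Q Y \<Longrightarrow> - P' x \<noteq> 0" for x using P'_nonzero[of x] by simp
    show "finite {x. \<bar>- P x\<bar> = Q Y}" "\<exists>x. \<bar>- P x\<bar> = Q Y" "\<exists>r. \<forall>x. r \<le> \<bar>x\<bar> \<longrightarrow> Q Y < \<bar>- P x\<bar>"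
      using P_finite P_attains P_large by simp_all
  qed (fact Q Q'_cont Q_odd Y \<kappa> Q'_outer Q_inner)+
  let ?r = "\<lambda>z :: real \<times> real. (fst z, - snd z)"
  have eq: "lower_side = ?r ` refl.upper_side"
  proof
    show "lower_side \<subseteq> ?r ` refl.upper_side"
    proof
      fix z assume "z \<in> lower_side"
      then show "z \<in> ?r ` refl.upper_side"
        by (intro image_eqI[of _ _ "?r z"]) (auto simp: lower_side_def refl.upper_side_def Q_odd)
    qed
  qed (auto simp: lower_side_def refl.upper_side_def Q_odd)
  show "connected lower_side"
    unfolding eq by (intro connected_continuous_image refl.connected_upper_side continuous_intros)
  show "lower_side \<noteq> {}" using refl.top_region_nonempty refl.top_region_subset eq by auto
  have "lower_side = {z. Q (snd z) < P (fst z)}" by (auto simp: lower_side_def)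
  then show "open lower_side"
    by (auto intro!: open_Collect_less continuous_on_compose2[OF P_cont] continuous_on_compose2[OF Q_cont] continuous_intros)
qed

lemma card_components_complement_Z: "card (components (- Z)) = 2"
proof -
  have "- Z = upper_side \<union> lower_side" by (auto simp: Z_def upper_side_def lower_side_def)
  moreover have "upper_side \<inter> lower_side = {}" by (auto simp: upper_side_def lower_side_def)
  moreover have "upper_side \<noteq> {}" using top_region_nonempty top_region_subset by auto
  moreover from calculation have "upper_side \<noteq> lower_side" by blast
  ultimately show ?thesis
    using components_Un_open[OF open_upper_side lower_side(1) connected_upper_side lower_side(2)] lower_side(3) by simp
qed

end

section \<open>Hermite polynomials\<close>

text \<open>A uniform recurrence: at \<open>n = 0\<close> the factor \<open>real n\<close> removes
  the term with the truncated index \<open>n - 1\<close>.\<close>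

lemma hermite_Suc: "hermite (Suc n) t = 2 * t * hermite n t - 2 * real n * hermite (n - 1) t"
  by (cases n) auto

lemma hermite_has_derivative: "(hermite n has_real_derivative 2 * real n * hermite (n - 1) t) (at t)"
proof (induction n arbitrary: t rule: induct_nat_012)
  case 0
  have "hermite 0 = (\<lambda>t. 1)" by auto
  then show ?case by simp
next
  case 1
  have "hermite (Suc 0) = (\<lambda>t. 2 * t)" by auto
  then show ?case by (auto intro!: derivative_eq_intros)
next
  case (ge2 m)
  have "((\<lambda>t. 2 * t * hermite (Suc m) t - 2 * real (Suc m) * hermite m t) has_real_derivative
      2 * hermite (Suc m) t + 2 * t * (2 * real (Suc m) * hermite m t)
      - 2 * real (Suc m) * (2 * real m * hermite (m - 1) t)) (at t)"
    by (rule derivative_eq_intros ge2 refl | simp)+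
  also have "2 * hermite (Suc m) t + 2 * t * (2 * real (Suc m) * hermite m t)
      - 2 * real (Suc m) * (2 * real m * hermite (m - 1) t) =
      2 * hermite (Suc m) t + 2 * real (Suc m) * (2 * t * hermite m t - 2 * real m * hermite (m - 1) t)"
    by (simp only: algebra_simps)
  also have "\<dots> = 2 * real (Suc (Suc m)) * hermite (Suc (Suc m) - 1) t"
    unfolding hermite_Suc[of m t, symmetric] by (simp add: algebra_simps del: hermite.simps)
  finally show ?case by simp
qed

lemma hermite_minus: "hermite n (- t) = (- 1) ^ n * hermite n t"
  by (induction n t rule: hermite.induct) (auto simp: algebra_simps)

text \<open>A common zero of two neighbours would descend along the recurrence to
  \<open>hermite 0\<close>, which is 1. With the derivative formula this excludes multiple
  roots.\<close>

lemma hermite_no_common_zero: "hermite n t = 0 \<Longrightarrow> hermite (Suc n) t \<noteq> 0"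
  by (induction n) auto

text \<open>Both bounds are carried through one induction: since
  \<open>2 * (n + 1) \<le> t * t\<close>, the subtracted term of the recurrence is at most
  \<open>t * hermite (Suc n) t\<close>, half of the leading term.\<close>

lemma hermite_ge:
  "2 * real n + 2 \<le> t \<Longrightarrow> 1 \<le> hermite n t \<and> t * hermite n t \<le> hermite (Suc n) t"
proof (induction n)
  case 0
  then show ?case by simp
next
  case (Suc n)
  then have IH: "1 \<le> hermite n t" "t * hermite n t \<le> hermite (Suc n) t" and t: "2 * real n + 4 \<le> t"
    by simp_all
  have *: "1 * 1 \<le> t * hermite n t" using IH t by (intro mult_mono) auto
  have "2 * (1 + real n) * hermite n t \<le> t * (t * hermite n t)"
  proof -
    have "2 * (1 + real n) * 1 \<le> t * t" using t by (intro mult_mono) auto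
    then have "2 * (1 + real n) \<le> t * t" by simp
    then have "2 * (1 + real n) * hermite n t \<le> (t * t) * hermite n t"
      using IH by (intro mult_right_mono) auto
    then show ?thesis by (simp add: mult.assoc)
  qed
  also have "t * (t * hermite n t) \<le> t * hermite (Suc n) t"
    using IH t by (intro mult_left_mono) auto
  finally show ?case using IH * by simp
qed

lemma real_polynomial_function_hermite: "real_polynomial_function (hermite n)"
proof (induction n rule: induct_nat_012)
  case 0
  have "hermite 0 = (\<lambda>t. 1)" by auto
  then show ?case by (simp add: real_polynomial_function.intros)
next
  case 1
  have "hermite (Suc 0) = (\<lambda>t. 2 * t)" by auto
  then show ?case by (simp add: real_polynomial_function.intros bounded_linear_mult_right)
next
  case (ge2 m)
  have "hermite (Suc (Suc m)) = (\<lambda>t. 2 * t * hermite (Suc m) t - 2 * real (Suc m) * hermite m t)" by auto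
  moreover have "real_polynomial_function \<dots>"
    by (intro real_polynomial_function_diff real_polynomial_function.intros ge2
        bounded_linear_ident)
  ultimately show ?case by simp
qed

lemma real_polynomial_function_finite_zeros:
  fixes f :: "real \<Rightarrow> real"
  assumes "real_polynomial_function f" "f a \<noteq> 0"
  shows "finite {x. f x = 0}"
proof -
  obtain c n where f: "f = (\<lambda>x. \<Sum>i\<le>n. c i * x ^ i)"
    using assms(1) by (auto simp: real_polynomial_function_iff_sum)
  have "\<exists>k\<le>n. c k \<noteq> 0"
  proof (rule ccontr)
    assume "\<not> ?thesis"
    then show False using assms(2) by (simp add: f)
  qed
  then show ?thesis unfolding f by (subst polyfun_finite_roots) auto
qed

lemma continuous_on_hermite: "continuous_on S (hermite n)"
  by (rule continuous_at_imp_continuous_on) (blast intro: DERIV_isCont hermite_has_derivative)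

section \<open>Odd degree: growth, critical values and the level curve\<close>

context
  fixes n :: nat
  assumes odd_n: "odd n"
begin

lemma hermite_odd: "hermite n (- t) = - hermite n t"
  using hermite_minus[of n t] odd_n by simp

lemma hermite_abs: "\<bar>hermite n \<bar>t\<bar>\<bar> = \<bar>hermite n t\<bar>"
  using hermite_odd[of t] by (simp add: abs_if)

lemma hermite_pred_outer: "1 \<le> hermite (n - 1) t" if "2 * real n \<le> \<bar>t\<bar>"
proof -
  have "hermite (n - 1) \<bar>t\<bar> = hermite (n - 1) t"
    using hermite_minus[of "n - 1" t] odd_n by (simp add: abs_if)
  moreover have "2 * real (n - 1) + 2 \<le> \<bar>t\<bar>" using that odd_pos[OF odd_n] by simp
  ultimately show ?thesis using hermite_ge[of "n - 1" "\<bar>t\<bar>"] by simp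
qed

lemma hermite_derivative_outer: "2 \<le> 2 * real n * hermite (n - 1) t" if "2 * real n \<le> \<bar>t\<bar>"
proof -
  have "2 * 1 * 1 \<le> 2 * real n * hermite (n - 1) t"
    using hermite_pred_outer[OF that] odd_pos[OF odd_n] by (intro mult_mono) auto
  then show ?thesis by simp
qed

lemma hermite_outer: "\<bar>t\<bar> \<le> \<bar>hermite n t\<bar>" if "2 * real n \<le> \<bar>t\<bar>"
proof -
  have "2 * real (n - 1) + 2 \<le> \<bar>t\<bar>" using that odd_pos[OF odd_n] by simp
  from hermite_ge[OF this]
  have *: "1 \<le> hermite (n - 1) \<bar>t\<bar>" "\<bar>t\<bar> * hermite (n - 1) \<bar>t\<bar> \<le> hermite n \<bar>t\<bar>"
    using odd_pos[OF odd_n] by auto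
  have "\<bar>t\<bar> * 1 \<le> \<bar>t\<bar> * hermite (n - 1) \<bar>t\<bar>" using * by (intro mult_left_mono) auto
  then have "\<bar>t\<bar> \<le> hermite n \<bar>t\<bar>" using * by simp
  then show ?thesis using hermite_abs[of t] by simp
qed

lemma hermite_strict_mono: "hermite n s < hermite n t" if "2 * real n \<le> s" "s < t"
proof (rule DERIV_pos_imp_increasing[OF \<open>s < t\<close>])
  fix u assume "s \<le> u" "u \<le> t"
  then have "2 \<le> 2 * real n * hermite (n - 1) u" using that by (intro hermite_derivative_outer) simp
  then show "\<exists>d. (hermite n has_real_derivative d) (at u) \<and> d > 0"
    using hermite_has_derivative[of n u] by (intro exI[of _ "2 * real n * hermite (n - 1) u"]) simp
qed

lemma hermite_height:
  obtains Y where "2 * real n \<le> Y" "0 < Y" "\<And>t. \<bar>t\<bar> < Y \<Longrightarrow> \<bar>hermite n t\<bar> < hermite n Y"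
proof -
  have "compact (hermite n ` {- 2 * real n..2 * real n})"
    by (intro compact_continuous_image continuous_on_hermite compact_Icc)
  from compact_imp_bounded[OF this]
  obtain M where M: "\<forall>t\<in>{- 2 * real n..2 * real n}. \<bar>hermite n t\<bar> \<le> M"
    unfolding bounded_iff by auto
  \<comment> \<open>Beyond \<open>2 * real n\<close> the polynomial increases and dominates
    \<open>t\<close>; hence its value at \<open>Y\<close> exceeds the bound \<open>M\<close> on the
    middle interval as well as all values between that interval and \<open>Y\<close>.\<close>
  define Y where "Y = max (2 * real n + 1) (M + 1)"
  have Y: "2 * real n < Y" "M < Y" "0 < Y" by (auto simp: Y_def)
  have pos: "0 < hermite n t" if "2 * real n \<le> t" "0 < t" for t
  proof -
    have *: "1 \<le> hermite (n - 1) t" "t * hermite (n - 1) t \<le> hermite n t"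
      using hermite_ge[of "n - 1" t] that odd_pos[OF odd_n] by auto
    have "0 < t * hermite (n - 1) t" using * that by (intro mult_pos_pos) auto
    then show ?thesis using * by simp
  qed
  have HY: "Y \<le> hermite n Y" using hermite_outer[of Y] pos[of Y] Y by simp
  have inner: "\<bar>hermite n t\<bar> < hermite n Y" if "\<bar>t\<bar> < Y" for t
  proof (cases "\<bar>t\<bar> \<le> 2 * real n")
    case True
    then have "\<bar>hermite n t\<bar> \<le> M" by (intro bspec[OF M]) auto
    then show ?thesis using HY Y by simp
  next
    case False
    then have "hermite n \<bar>t\<bar> < hermite n Y" "0 < hermite n \<bar>t\<bar>"
      using hermite_strict_mono[of "\<bar>t\<bar>" Y] pos[of "\<bar>t\<bar>"] that odd_pos[OF odd_n] by auto
    then show ?thesis using hermite_abs[of t] by simp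
  qed
  show thesis by (rule that[OF less_imp_le[OF Y(1)] Y(3) inner])
qed

text \<open>The sum of \<open>\<bar>hermite n t\<bar>\<close> and
  \<open>\<bar>hermite (n - 1) t\<bar>\<close> has a positive minimum on a compact interval
  containing all zeros of \<open>hermite (n - 1)\<close>; at such a zero only the first summand
  remains.\<close>

lemma hermite_critical_values:
  obtains m where "0 < m" "\<And>t. hermite (n - 1) t = 0 \<Longrightarrow> m \<le> \<bar>hermite n t\<bar>"
proof -
  let ?K = "{- 2 * real n..2 * real n}" and ?f = "\<lambda>t. \<bar>hermite n t\<bar> + \<bar>hermite (n - 1) t\<bar>"
  have "continuous_on ?K ?f" by (intro continuous_intros continuous_on_hermite)
  moreover have "?K \<noteq> {}" by simp
  ultimately obtain a where a: "\<forall>t\<in>?K. ?f a \<le> ?f t"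
    using continuous_attains_inf[OF compact_Icc] by blast
  have "hermite n a \<noteq> 0 \<or> hermite (n - 1) a \<noteq> 0"
    using hermite_no_common_zero[of "n - 1" a] odd_pos[OF odd_n] by auto
  then have "0 < ?f a" by auto
  moreover have "?f a \<le> \<bar>hermite n t\<bar>" if "hermite (n - 1) t = 0" for t
  proof -
    have "\<bar>t\<bar> \<le> 2 * real n" using hermite_pred_outer[of t] that by (cases "\<bar>t\<bar> \<le> 2 * real n") auto
    then have "t \<in> ?K" by auto
    from bspec[OF a this] show ?thesis using that by simp
  qed
  ultimately show thesis using that by blast
qed

text \<open>Here \<open>a\<close> and \<open>b\<close> stand for \<open>cos \<theta>\<close> and
  \<open>sin \<theta>\<close>. The slope \<open>b * 2\<close> comes from the lower bound 2 for the
  derivative far out, and \<open>b * hermite n Y < a * m\<close> lifts the critical values above the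
  cutting level.\<close>

lemma hermite_level_curve:
  assumes Y: "2 * real n \<le> Y" "0 < Y" "\<And>t. \<bar>t\<bar> < Y \<Longrightarrow> \<bar>hermite n t\<bar> < hermite n Y"
    and m: "\<And>t. hermite (n - 1) t = 0 \<Longrightarrow> m \<le> \<bar>hermite n t\<bar>"
    and ab: "0 < a" "0 < b" "b * hermite n Y < a * m"
  shows "separated_level_curve (\<lambda>x. - a * hermite n x) (\<lambda>x. - a * (2 * real n * hermite (n - 1) x))
    (\<lambda>y. b * hermite n y) (\<lambda>y. b * (2 * real n * hermite (n - 1) y)) Y (b * 2)"
proof
  let ?s = "b * hermite n Y"
  have HY: "0 < hermite n Y" using Y(3)[of 0] Y(2) by simp
  then have s: "0 < ?s" using ab by simp
  show "((\<lambda>x. - a * hermite n x) has_real_derivative - a * (2 * real n * hermite (n - 1) x)) (at x)" for x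
    by (rule DERIV_cmult[OF hermite_has_derivative])
  show "((\<lambda>y. b * hermite n y) has_real_derivative b * (2 * real n * hermite (n - 1) y)) (at y)" for y
    by (rule DERIV_cmult[OF hermite_has_derivative])
  show "continuous_on UNIV (\<lambda>x. - a * (2 * real n * hermite (n - 1) x))"
    "continuous_on UNIV (\<lambda>y. b * (2 * real n * hermite (n - 1) y))"
    by (intro continuous_intros continuous_on_hermite)+
  show "b * hermite n (- y) = - (b * hermite n y)" for y by (simp add: hermite_odd)
  show "0 < Y" "0 < b * 2" using Y ab by auto
  show "b * 2 \<le> b * (2 * real n * hermite (n - 1) y)" if "Y \<le> \<bar>y\<bar>" for y
    using ab Y that by (intro mult_left_mono hermite_derivative_outer) auto
  show "\<bar>b * hermite n y\<bar> < ?s" if "\<bar>y\<bar> < Y" for y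
    using Y(3)[OF that] ab by (simp add: abs_mult)
  show "- a * (2 * real n * hermite (n - 1) x) \<noteq> 0" if "\<bar>- a * hermite n x\<bar> \<le> ?s" for x
  proof
    assume "- a * (2 * real n * hermite (n - 1) x) = 0"
    then have "m \<le> \<bar>hermite n x\<bar>" using m ab odd_pos[OF odd_n] by auto
    then have "a * m \<le> a * \<bar>hermite n x\<bar>" using ab by simp
    also have "\<dots> = \<bar>- a * hermite n x\<bar>" using ab by (simp add: abs_mult)
    finally show False using that ab by linarith
  qed
  \<comment> \<open>Beyond \<open>2 * real n\<close> one has
    \<open>\<bar>x\<bar> \<le> \<bar>hermite n x\<bar>\<close>, so exceeding \<open>?s / a\<close>
    suffices.\<close>
  have large: "?s < \<bar>- a * hermite n x\<bar>" if "max (2 * real n) (?s / a) + 1 \<le> \<bar>x\<bar>" for x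
  proof -
    have "2 * real n \<le> \<bar>x\<bar>" "?s / a < \<bar>x\<bar>" using that by auto
    then have "?s / a < \<bar>hermite n x\<bar>" using hermite_outer[of x] by simp
    then show ?thesis using ab by (simp add: abs_mult field_simps)
  qed
  then show "\<exists>r. \<forall>x. r \<le> \<bar>x\<bar> \<longrightarrow> ?s < \<bar>- a * hermite n x\<bar>" by blast
  have zero: "hermite n 0 = 0" using hermite_odd[of 0] by simp
  show "\<exists>x. \<bar>- a * hermite n x\<bar> = ?s"
  proof -
    let ?b = "max (2 * real n) (?s / a) + 1"
    have "\<exists>x\<ge>0. x \<le> ?b \<and> \<bar>- a * hermite n x\<bar> = ?s"
    proof (rule IVT')
      show "\<bar>- a * hermite n 0\<bar> \<le> ?s" using s zero by simp
      show "?s \<le> \<bar>- a * hermite n ?b\<bar>" by (rule less_imp_le[OF large]) simp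
      show "continuous_on {0..?b} (\<lambda>x. \<bar>- a * hermite n x\<bar>)"
        by (intro continuous_intros continuous_on_hermite)
    qed simp
    then show ?thesis by blast
  qed
  \<comment> \<open>The cuts solve two polynomial equations, with \<open>c\<close> equal to
    \<open>?s\<close> or \<open>- ?s\<close>; neither polynomial is zero, as its value at 0 is
    \<open>- c\<close>.\<close>
  have "finite {x. - a * hermite n x - c = 0}" if "c \<noteq> 0" for c
  proof (rule real_polynomial_function_finite_zeros[where a = 0])
    show "real_polynomial_function (\<lambda>x. - a * hermite n x - c)"
      by (intro real_polynomial_function_diff real_polynomial_function.intros
          real_polynomial_function_hermite)
    show "- a * hermite n 0 - c \<noteq> 0" using zero that by simp
  qed
  then have "finite {x. - a * hermite n x - ?s = 0}" "finite {x. - a * hermite n x - (- ?s) = 0}"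
    using s by (metis less_irrefl, metis less_irrefl neg_equal_0_iff_equal)
  then have "finite ({x. - a * hermite n x - ?s = 0} \<union> {x. - a * hermite n x - (- ?s) = 0})"
    by (rule finite_UnI)
  then show "finite {x. \<bar>- a * hermite n x\<bar> = ?s}"
    by (rule finite_subset[rotated]) (auto simp: abs_if split: if_splits)
qed

end

section \<open>Choice of the threshold angle and conclusion\<close>

theorem theorem1p4:
  fixes n :: nat
  assumes "odd n"
  shows "\<exists>\<theta>\<^sub>c::real. \<theta>\<^sub>c > 0 \<and>
           (\<forall>\<theta>. 0 < \<theta> \<and> \<theta> < \<theta>\<^sub>c \<and> \<theta> < pi \<longrightarrow>
              connected (nodal_set (Phi n \<theta>)) \<and>
              simple_regular_curve (nodal_set (Phi n \<theta>)) \<and>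
              card (nodal_domains (Phi n \<theta>)) = 2)"
proof -
  obtain Y where Y: "2 * real n \<le> Y" "0 < Y" "\<And>t. \<bar>t\<bar> < Y \<Longrightarrow> \<bar>hermite n t\<bar> < hermite n Y"
    using hermite_height[OF assms] by blast
  obtain m where m: "0 < m" "\<And>t. hermite (n - 1) t = 0 \<Longrightarrow> m \<le> \<bar>hermite n t\<bar>"
    using hermite_critical_values[OF assms] by blast
  have HY: "0 < hermite n Y" using Y(3)[of 0] Y(2) by simp
  \<comment> \<open>The bound \<open>pi / 3\<close> ensures \<open>cos \<theta> > 1 / 2\<close>, and
    the other one gives \<open>sin \<theta> * hermite n Y < m / 2\<close>; together they separate
    the critical values.\<close>
  define \<theta>\<^sub>c where "\<theta>\<^sub>c = min (pi / 3) (m / (2 * hermite n Y))"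
  have "\<theta>\<^sub>c > 0" using m HY by (simp add: \<theta>\<^sub>c_def)
  moreover have "connected (nodal_set (Phi n \<theta>)) \<and> simple_regular_curve (nodal_set (Phi n \<theta>)) \<and>
      card (nodal_domains (Phi n \<theta>)) = 2" if \<theta>: "0 < \<theta>" "\<theta> < \<theta>\<^sub>c" for \<theta>
  proof -
    have \<theta>': "\<theta> < pi / 3" "\<theta> < m / (2 * hermite n Y)" using \<theta> by (auto simp: \<theta>\<^sub>c_def)
    have sin: "0 < sin \<theta>" "sin \<theta> \<le> \<theta>" using \<theta> \<theta>' by (auto intro: sin_gt_zero sin_x_le_x)
    have "cos (pi / 3) < cos \<theta>" using \<theta> \<theta>' by (intro cos_monotone_0_pi) auto
    then have cos: "1 / 2 < cos \<theta>" by (simp add: cos_60)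
    have "sin \<theta> * hermite n Y \<le> \<theta> * hermite n Y" using sin HY by simp
    also have "\<dots> < 1 / 2 * m" using \<theta>' HY by (simp add: field_simps)
    also have "\<dots> < cos \<theta> * m" using cos m by (intro mult_strict_right_mono)
    finally have lt: "sin \<theta> * hermite n Y < cos \<theta> * m" .
    interpret separated_level_curve "\<lambda>x. - cos \<theta> * hermite n x" "\<lambda>x. - cos \<theta> * (2 * real n * hermite (n - 1) x)"
      "\<lambda>y. sin \<theta> * hermite n y" "\<lambda>y. sin \<theta> * (2 * real n * hermite (n - 1) y)" Y "sin \<theta> * 2"
      using hermite_level_curve[OF assms Y m(2) _ sin(1) lt] cos by simp
    have "{z. Phi n \<theta> z = 0} = Z" unfolding Z_def by (auto simp: Phi_def)
    then have N: "nodal_set (Phi n \<theta>) = Z" using closed_Z by (simp add: nodal_set_def)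
    have poly: "polynomial_function (\<lambda>z. c * (2 * real n * hermite (n - 1) (f z)))"
      if "bounded_linear f" for c and f :: "real \<times> real \<Rightarrow> real"
    proof -
      have "real_polynomial_function (hermite (n - 1) \<circ> f)"
        by (rule real_polynomial_function_compose)
          (simp_all add: that polynomial_function_bounded_linear real_polynomial_function_hermite)
      then show ?thesis unfolding real_polynomial_function_eq[symmetric] o_def
        by (intro real_polynomial_function.intros(2,4))
    qed
    have "polynomial_function V"
    proof -
      have "V = (\<lambda>z. (sin \<theta> * (2 * real n * hermite (n - 1) (snd z))) *\<^sub>R (1, 0) +
          (- cos \<theta> * (2 * real n * hermite (n - 1) (fst z))) *\<^sub>R (0, 1))"
        unfolding V_def by auto
      moreover have "polynomial_function \<dots>"
        by (intro polynomial_function_add polynomial_function_mult poly bounded_linear_fst bounded_linear_snd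
            polynomial_function_const)
      ultimately show ?thesis by simp
    qed
    from simple_regular_arc_flow_arc[OF Z_arc this V_nonzero]
    show ?thesis using card_components_complement_Z
      by (simp add: N nodal_domains_def simple_regular_curve_def)
  qed
  ultimately show ?thesis by blast
qed

end
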